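(* Let $d,a,b_1,\dots,b_n,c$ be positive integers with $d\mid q-1$, let $\lambda_1,\dots,\lambda_n\in\kappa^\times$, and let $S_{D,\lambda}$ be the $n$-dimensional affine hypersurface over $\kappa$ defined by $$y^d=\Big(1-\sum_{i=1}^n\lambda_ix_i\Big)^a\Big(\prod_{i=1}^nx_i^{b_i}\Big)\Big(1-\sum_{i=1}^nx_i\Big)^c,$$ with $\mu_d$ acting by $\xi\cdot(x_1,\dots,x_n,y)=(x_1,\dots,x_n,\xi y)$. Suppose that $\gcd(d,a)=\gcd(d,c)=1$. Then, for $m\in\mathbb{Z}/d\mathbb{Z}$, $$N_1(S_{D,\lambda};\chi^m)=\begin{cases}q^n&(m=0),\\ (-1)^nJ_D\cdot F_D^{(n)}\left({\overline{\varphi_d}^{ma};\varphi_d^{mb_1},\dots,\varphi_d^{mb_n}\atop\varphi_d^{m(b_1+\cdots+b_n+c)}};\lambda_1,\dots,\lambda_n\right)&(m\neq0),\end{cases}$$ where $J_D=j(\varphi_d^{mb_1},\dots,\varphi_d^{mb_n},\varphi_d^{mc})$.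
   Context: $\kappa$ is a finite field with $q$ elements of characteristic $p$. $\widehat{\kappa^\times}=\mathrm{Hom}(\kappa^\times,\overline{\mathbb{Q}}^\times)$ is the group of multiplicative characters, $\varepsilon$ the trivial character, $\overline{\eta}=\eta^{-1}$; every $\eta\in\widehat{\kappa^\times}$ (including $\varepsilon$) is extended to $\kappa$ by $\eta(0)=0$. $\delta(\eta)=1$ if $\eta=\varepsilon$ and $0$ otherwise. Fix a non-trivial additive character $\psi\in\mathrm{Hom}(\kappa,\overline{\mathbb{Q}}^\times)$. Put $$g(\eta)=-\sum_{x\in\kappa^\times}\psi(x)\eta(x),\quad g^\circ(\eta)=q^{\delta(\eta)}g(\eta),\quad j(\eta_1,\dots,\eta_k)=(-1)^{k-1}\sum_{x_i\in\kappa^\times,\ x_1+\cdots+x_k=1}\ \prod_{i=1}^k\eta_i(x_i)\ (k\ge 2),$$ $$(\alpha)_\nu=\frac{g(\alpha\nu)}{g(\alpha)},\qquad(\alpha)_\nu^\circ=\frac{g^\circ(\alpha\nu)}{g^\circ(\alpha)},$$ $$F_D^{(n)}\left({\alpha;\beta_1,\dots,\beta_n\atop\gamma};\lambda_1,\dots,\lambda_n\right)=\frac{1}{(1-q)^n}\sum_{\nu_1,\dots,\nu_n\in\widehat{\kappa^\times}}\frac{(\alpha)_{\nu_1\cdots\nu_n}(\beta_1)_{\nu_1}\cdots(\beta_n)_{\nu_n}}{(\gamma)^\circ_{\nu_1\cdots\nu_n}(\varepsilon)^\circ_{\nu_1}\cdots(\varepsilon)^\circ_{\nu_n}}\nu_1(\lambda_1)\cdots\nu_n(\lambda_n).$$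 $\mu_d\subset\kappa^\times$ is the group of $d$th roots of unity. Fix a generator $\varphi$ of $\widehat{\kappa^\times}$ and put $\varphi_d=\varphi^{(q-1)/d}$, $\chi=\varphi|_{\mu_d}$, so that $\widehat{\mu_d}=\{\chi^m\mid m\in\mathbb{Z}/d\mathbb{Z}\}$. For a variety $V$ over $\kappa$ with an action over $\kappa$ of a finite abelian group $G$, with $F$ the $q$-Frobenius on $V(\overline{\kappa})$, and for $\theta\in\mathrm{Hom}(G,\overline{\mathbb{Q}}^\times)$ and $r\ge1$, $$N_r(V;\theta)=\frac{1}{\#G}\sum_{g\in G}\theta(g)\,\#\{x\in V(\overline{\kappa})\mid F^r(x)=g(x)\}.$$ *)

theory Defs
  imports "HOL-Algebra.Algebra" "HOL-Algebra.Algebraic_Closure_Type"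
    "HOL-Library.Cardinality"
begin

type_synonym qbar = "rat alg_closure"

definition add_grp :: "'k :: field monoid"
  where "add_grp = add_monoid ring_of_type_algebra"

definition mult_grp :: "'k :: field monoid"
  where "mult_grp = mult_of ring_of_type_algebra"

definition mu :: "nat \<Rightarrow> 'k :: field monoid"
  where "mu d = mult_grp\<lparr>carrier := {x. x ^ d = 1}\<rparr>"

text \<open>
  The group \<open>Hom(G, qbar\<^sup>\<times>)\<close> under pointwise multiplication. A homomorphism is represented by the
  total function that vanishes outside \<open>carrier G\<close>; for \<open>G = mult_grp\<close> this is exactly the
  convention \<open>\<eta> 0 = 0\<close> for all multiplicative characters, including the trivial one.
\<close>

definition char_group :: "('g, 'm) monoid_scheme \<Rightarrow> ('g \<Rightarrow> qbar) monoid"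
  where "char_group G =
    \<lparr>carrier = {\<chi> \<in> hom G (mult_grp :: qbar monoid). \<forall>x. x \<notin> carrier G \<longrightarrow> \<chi> x = 0},
     monoid.mult = (\<lambda>\<eta> \<nu> x. \<eta> x * \<nu> x),
     one = (\<lambda>x. if x \<in> carrier G then 1 else 0)\<rparr>"

abbreviation mchars :: "('k :: {field, finite} \<Rightarrow> qbar) monoid"
  where "mchars \<equiv> char_group mult_grp"

definition char_restrict :: "('g, 'm) monoid_scheme \<Rightarrow> ('g \<Rightarrow> qbar) \<Rightarrow> 'g \<Rightarrow> qbar"
  where "char_restrict H \<chi> = (\<lambda>x. if x \<in> carrier H then \<chi> x else 0)"

definition gauss :: "('k :: {field, finite} \<Rightarrow> qbar) \<Rightarrow> ('k \<Rightarrow> qbar) \<Rightarrow> qbar"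
  where "gauss \<psi> \<eta> = - (\<Sum>x\<in>UNIV - {0}. \<psi> x * \<eta> x)"

definition char_delta :: "('k :: {field, finite} \<Rightarrow> qbar) \<Rightarrow> nat"
  where "char_delta \<eta> = (if \<eta> = \<one>\<^bsub>mchars\<^esub> then 1 else 0)"

definition gauss_circ :: "('k :: {field, finite} \<Rightarrow> qbar) \<Rightarrow> ('k \<Rightarrow> qbar) \<Rightarrow> qbar"
  where "gauss_circ \<psi> \<eta> = of_nat CARD('k) ^ char_delta \<eta> * gauss \<psi> \<eta>"

definition jacobi :: "nat \<Rightarrow> (nat \<Rightarrow> 'k :: {field, finite} \<Rightarrow> qbar) \<Rightarrow> qbar"
  where "jacobi k \<eta> = (-1) ^ (k - 1) *
    (\<Sum>x | x \<in> {1..k} \<rightarrow>\<^sub>E UNIV - {0} \<and> (\<Sum>i=1..k. x i) = 1. \<Prod>i=1..k. \<eta> i (x i))"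

definition poch :: "('k :: {field, finite} \<Rightarrow> qbar) \<Rightarrow> ('k \<Rightarrow> qbar) \<Rightarrow> ('k \<Rightarrow> qbar) \<Rightarrow> qbar"
  where "poch \<psi> \<alpha> \<nu> = gauss \<psi> (\<alpha> \<otimes>\<^bsub>mchars\<^esub> \<nu>) / gauss \<psi> \<alpha>"

definition poch_circ :: "('k :: {field, finite} \<Rightarrow> qbar) \<Rightarrow> ('k \<Rightarrow> qbar) \<Rightarrow> ('k \<Rightarrow> qbar) \<Rightarrow> qbar"
  where "poch_circ \<psi> \<alpha> \<nu> = gauss_circ \<psi> (\<alpha> \<otimes>\<^bsub>mchars\<^esub> \<nu>) / gauss_circ \<psi> \<alpha>"

definition lauricella_FD :: "('k :: {field, finite} \<Rightarrow> qbar) \<Rightarrow> nat \<Rightarrow> ('k \<Rightarrow> qbar) \<Rightarrow>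
    (nat \<Rightarrow> 'k \<Rightarrow> qbar) \<Rightarrow> ('k \<Rightarrow> qbar) \<Rightarrow> (nat \<Rightarrow> 'k) \<Rightarrow> qbar"
  where "lauricella_FD \<psi> n \<alpha> \<beta> \<gamma> l =
    1 / (1 - of_nat CARD('k)) ^ n *
    (\<Sum>\<nu>\<in>{1..n} \<rightarrow>\<^sub>E carrier mchars.
       (poch \<psi> \<alpha> (finprod mchars \<nu> {1..n}) * (\<Prod>i=1..n. poch \<psi> (\<beta> i) (\<nu> i))) /
       (poch_circ \<psi> \<gamma> (finprod mchars \<nu> {1..n}) *
          (\<Prod>i=1..n. poch_circ \<psi> \<one>\<^bsub>mchars\<^esub> (\<nu> i))) *
       (\<Prod>i=1..n. \<nu> i (l i)))"

text \<open>
  A variety \<open>V\<close> enters only through its set of geometric points, the Frobenius map \<open>F\<close>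
  and the action \<open>act\<close> of \<open>G\<close> on these points.
\<close>

definition twisted_count :: "('g, 'm) monoid_scheme \<Rightarrow> 'p set \<Rightarrow> ('p \<Rightarrow> 'p) \<Rightarrow> ('g \<Rightarrow> 'p \<Rightarrow> 'p) \<Rightarrow>
    nat \<Rightarrow> ('g \<Rightarrow> qbar) \<Rightarrow> qbar"
  where "twisted_count G V F act r \<theta> =
    1 / of_nat (card (carrier G)) *
    (\<Sum>g\<in>carrier G. \<theta> g * of_nat (card {x \<in> V. (F ^^ r) x = act g x}))"

type_synonym 'k point = "(nat \<Rightarrow> 'k alg_closure) \<times> 'k alg_closure"

definition S_D :: "nat \<Rightarrow> nat \<Rightarrow> nat \<Rightarrow> (nat \<Rightarrow> nat) \<Rightarrow> nat \<Rightarrow> (nat \<Rightarrow> 'k) \<Rightarrow> 'k :: {field, finite} point set"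
  where "S_D n d a b c l =
    {(x, y). x \<in> {1..n} \<rightarrow>\<^sub>E UNIV \<and>
       y ^ d = (1 - (\<Sum>i=1..n. to_ac (l i) * x i)) ^ a * (\<Prod>i=1..n. x i ^ b i) *
               (1 - (\<Sum>i=1..n. x i)) ^ c}"

definition frob :: "nat \<Rightarrow> 'k :: {field, finite} point \<Rightarrow> 'k point"
  where "frob n = (\<lambda>(x, y). (\<lambda>i\<in>{1..n}. x i ^ CARD('k), y ^ CARD('k)))"

definition mu_act :: "'k :: {field, finite} \<Rightarrow> 'k point \<Rightarrow> 'k point"
  where "mu_act \<xi> = (\<lambda>(x, y). (x, to_ac \<xi> * y))"

lemma mult_grp_simps [simp]:
  "carrier mult_grp = UNIV - {0}" "x \<otimes>\<^bsub>mult_grp\<^esub> y = x * y" "\<one>\<^bsub>mult_grp\<^esub> = 1"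
  by (simp_all add: mult_grp_def mult_of_def ring_of_type_algebra_def)

lemma comm_group_char_group:
  assumes "Group.group G"
  shows "comm_group (char_group G)"
proof -
  interpret G: Group.group G by fact
  show ?thesis
  proof (rule comm_groupI)
    fix \<chi> assume \<chi>: "\<chi> \<in> carrier (char_group G)"
    show "\<exists>\<eta>\<in>carrier (char_group G). \<eta> \<otimes>\<^bsub>char_group G\<^esub> \<chi> = \<one>\<^bsub>char_group G\<^esub>"
      using \<chi> by (intro bexI[of _ "\<lambda>x. inverse (\<chi> x)"])
        (auto simp: char_group_def hom_def Pi_def fun_eq_iff)
  qed (auto simp: char_group_def hom_def Pi_def fun_eq_iff mult_ac)
qed

end

theory Submission
  imports Defs
begin

text \<open>
  The theorem is the finite-field counterpart of Euler's integral for Lauricella's \<open>F\<^sub>D\<close>, and both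
  sides are evaluated as the same character sum over rational points \<open>x\<close> of affine \<open>n\<close>-space.

  On the geometric side, let \<open>f\<close> be the right-hand side of the equation \<open>y\<^sup>d = f(x)\<close>. A twisted fixed
  point has rational \<open>x\<close>, and above a rational \<open>x\<close> with \<open>f(x) \<noteq> 0\<close> Frobenius multiplies all \<open>d\<close>
  values of \<open>y\<close> by the power residue \<open>f(x)\<^sup>(\<^sup>q\<^sup>-\<^sup>1\<^sup>)\<^sup>/\<^sup>d\<close>. Averaging against \<open>\<chi>\<^sup>m\<close> therefore yields the
  sum of \<open>\<omega>(f(x))\<close> for \<open>\<omega> = \<phi>\<^sub>d\<^sup>m\<close>; the zeros of \<open>f\<close> count once if \<open>\<chi>\<^sup>m\<close> is trivial and not at all
  otherwise (\<open>frobenius_fibre\<close>, \<open>twisted_count_S_D\<close>). For \<open>m = 0\<close> every \<open>x\<close> counts once, which gives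
  \<open>q\<^sup>n\<close>.

  On the hypergeometric side, two facts about Gauss sums do the work. A Jacobi sum is a quotient
  of Gauss sums as soon as one of its characters is non-trivial (\<open>jacobi_gauss_circ\<close>), and a
  non-trivial character of \<open>1 - u\<^sub>1 - \<dots> - u\<^sub>n\<close> has a multinomial expansion whose coefficients are
  Gauss sums (\<open>inverse_mchar_expansion\<close>), which comes from the Fourier expansion of \<open>\<psi>\<close> over
  multiplicative characters. By the first, multiplying \<open>F\<^sub>D\<close> by \<open>J\<^sub>D\<close> turns each term of the series into
  a Jacobi sum with shifted parameters, that is, into a sum over \<open>x\<close>; by the second, the sum over
  \<open>\<nu>\<close> then closes up to \<open>\<omega>((1 - \<Sum> \<lambda>\<^sub>i x\<^sub>i)\<^sup>a)\<close> (\<open>jacobi_times_lauricella_FD\<close>). The conditions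
  \<open>gcd(d, c) = 1\<close> and \<open>gcd(d, a) = 1\<close> ensure that the two characters concerned, \<open>\<omega>\<^sup>c\<close> and \<open>\<omega>\<^sup>-\<^sup>a\<close>, are
  non-trivial for \<open>m \<noteq> 0\<close>.

  The orthogonality relations for multiplicative characters with values in \<open>qbar\<close> come from
  evaluating characters at a generator of the group of units, which identifies them with the
  \<open>(q - 1)\<close>-th roots of unity.
\<close>

section \<open>Roots of binomials and finite fields\<close>

text \<open>
  The polynomial \<open>X\<^sup>N - t\<close> splits, and a repeated root would be a common zero with its derivative
  \<open>N X\<^sup>N\<^sup>-\<^sup>1\<close>, whose only zero is \<open>0\<close>. This is applied twice: over \<open>qbar\<close> it counts the
  multiplicative characters, and over the closure of the finite field it counts the points of the
  cover above a given base point.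
\<close>
lemma card_nth_roots_alg_closed:
  fixes t :: "'a :: alg_closed_field"
  assumes "of_nat N \<noteq> (0 :: 'a)" and "t \<noteq> 0"
  shows "card {z. z ^ N = t} = N"
proof -
  from assms(1) have N: "N > 0" by (cases N) auto
  define p where "p = monom 1 N - [:t:]"
  have poly_p: "poly p z = z ^ N - t" for z
    by (simp add: p_def poly_monom)
  have deg: "degree p = N"
    unfolding p_def using N by (subst diff_conv_add_uminus, subst degree_add_eq_left) (auto simp: degree_monom_eq)
  hence "p \<noteq> 0" using N by auto
  have lead: "lead_coeff p = 1"
    using N unfolding deg by (cases N) (auto simp: p_def)
  obtain A where A: "size A = N" "p = (\<Prod>x\<in>#A. [:-x, 1:])"
    using alg_closed_imp_factorization[OF \<open>p \<noteq> 0\<close>] lead deg by auto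
  have roots: "set_mset A = {z. z ^ N = t}"
  proof -
    have "poly p z = 0 \<longleftrightarrow> z \<in># A" for z
      by (auto simp: A(2) poly_prod_mset prod_mset_zero_iff)
    thus ?thesis by (auto simp: poly_p)
  qed
  have "count A z \<le> 1" for z
  proof (rule ccontr)
    assume "\<not> count A z \<le> 1"
    hence "replicate_mset 2 z \<subseteq># A" by (simp flip: count_le_replicate_mset_subset_eq)
    then obtain B where "A = replicate_mset 2 z + B" by (metis subset_mset.add_diff_inverse)
    hence B: "A = add_mset z (add_mset z B)" by (simp add: numeral_2_eq_2)
    define r where "r = (\<Prod>x\<in>#B. [:-x, 1:])"
    have "p = [:-z, 1:] * ([:-z, 1:] * r)"
      by (simp only: A(2) B image_mset_add_mset prod_mset.add_mset r_def)
    hence "poly (pderiv p) z = 0"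
      by (simp only: pderiv_mult poly_add poly_mult) simp
    moreover have "poly (pderiv p) z = of_nat N * z ^ (N - 1)"
      by (simp add: p_def pderiv_diff pderiv_monom poly_monom pderiv_pCons)
    ultimately have "z = 0" using assms(1) by auto
    moreover have "z \<in># A" using B by auto
    ultimately show False using roots N assms(2) by auto
  qed
  hence "mset_set (set_mset A) = A"
    by (intro multiset_eqI) (metis count_mset_set(1,3) count_eq_zero_iff finite_set_mset le_antisym less_one linorder_not_le)
  hence "size A = card (set_mset A)"
    by (metis size_mset_set)
  thus ?thesis using A(1) roots by simp
qed

text \<open>
  With \<open>r = k mod N\<close>, there are \<open>N\<close> solutions of \<open>z ^ N = 1\<close> but only \<open>r < N\<close> of \<open>z ^ r = 1\<close>, so
  \<open>k\<close> cannot kill all of the former.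
\<close>
lemma ex_root_of_unity_power_neq_1:
  fixes k :: int
  assumes "N > 0" and "\<not> int N dvd k"
  shows "\<exists>z :: qbar. z ^ N = 1 \<and> z powi k \<noteq> 1"
proof (rule ccontr)
  assume *: "\<nexists>z :: qbar. z ^ N = 1 \<and> z powi k \<noteq> 1"
  define r where "r = nat (k mod int N)"
  have r: "r > 0" "r < N" "int r = k mod int N"
    using assms pos_mod_bound[of "int N" k] pos_mod_sign[of "int N" k]
    unfolding r_def dvd_eq_mod_eq_0 by linarith+
  have fin: "finite {z :: qbar. z ^ r = 1}" and le: "card {z :: qbar. z ^ r = 1} = r"
    using card_nth_roots_alg_closed[of r "1 :: qbar"] r(1) by (auto intro: card_ge_0_finite)
  have "{z :: qbar. z ^ N = 1} \<subseteq> {z. z ^ r = 1}"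
  proof safe
    fix z :: qbar assume z: "z ^ N = 1"
    hence "z \<noteq> 0" using assms(1) by (auto simp: power_0_left)
    have "z powi k = z powi (int N * (k div int N) + int r)"
      by (simp add: r(3))
    also have "\<dots> = z ^ r"
      using \<open>z \<noteq> 0\<close> z by (simp add: power_int_add power_int_mult)
    finally show "z ^ r = 1" using * z by auto
  qed
  from card_mono[OF fin this] show False
    using le r(2) assms(1) card_nth_roots_alg_closed[of N "1 :: qbar"] by auto
qed

text \<open>
  The sum of all elements of the field is invariant under translation by \<open>1\<close>.
\<close>
lemma of_nat_CARD_eq_0: "of_nat CARD('k) = (0 :: 'k :: {field, finite})"
proof -
  have "\<Sum>(UNIV :: 'k set) = (\<Sum>x\<in>UNIV. x + 1)"
    by (rule sum.reindex_bij_witness[of _ "\<lambda>x. x + 1" "\<lambda>x. x - 1"]) auto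
  thus ?thesis by (simp add: sum.distrib)
qed

lemma CARD_ge_2: "CARD('k :: {field, finite}) \<ge> 2"
  using card_mono[of UNIV "{0, 1 :: 'k}"] by simp

lemma power_CARD_minus_1:
  assumes "(x :: 'k :: {field, finite}) \<noteq> 0"
  shows "x ^ (CARD('k) - 1) = 1"
proof -
  have "(\<Prod>y\<in>UNIV - {0}. y) = (\<Prod>y\<in>UNIV - {0}. x * y)"
    by (rule prod.reindex_bij_witness[of _ "\<lambda>y. x * y" "\<lambda>y. y / x"]) (use assms in auto)
  also have "\<dots> = x ^ (CARD('k) - 1) * (\<Prod>y\<in>UNIV - {0}. y)"
    by (simp add: prod.distrib card_Diff_singleton)
  finally show ?thesis by simp
qed

lemma power_CARD: "x ^ CARD('k) = (x :: 'k :: {field, finite})"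
proof (cases "x = 0")
  case False
  have "x ^ CARD('k) = x * x ^ (CARD('k) - 1)"
    using CARD_ge_2[where 'k = 'k] by (cases "CARD('k)") auto
  thus ?thesis using power_CARD_minus_1[OF False] by simp
qed auto

text \<open>
  The \<open>q\<close> elements of the finite field are roots of \<open>X\<^sup>q - X\<close>, and there is no room for others.
\<close>
lemma range_to_ac_eq_frobenius_fixed:
  "range (to_ac :: 'k :: {field, finite} \<Rightarrow> _) = {z. z ^ CARD('k) = z}"
proof (rule card_seteq)
  let ?q = "CARD('k)"
  define p :: "'k alg_closure poly" where "p = monom 1 ?q - [:0, 1:]"
  have q: "?q > 1" using CARD_ge_2[where 'k = 'k] by simp
  have deg: "degree p = ?q"
    unfolding p_def using q by (subst diff_conv_add_uminus, subst degree_add_eq_left) (auto simp: degree_monom_eq)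
  hence "p \<noteq> 0" by auto
  have eq: "{z. poly p z = 0} = {z. z ^ ?q = z}"
    by (auto simp: p_def poly_monom)
  show "finite {z :: 'k alg_closure. z ^ ?q = z}"
    using poly_roots_finite[OF \<open>p \<noteq> 0\<close>] eq by simp
  show "card {z :: 'k alg_closure. z ^ ?q = z} \<le> card (range (to_ac :: 'k \<Rightarrow> _))"
    using card_poly_roots_bound[OF \<open>p \<noteq> 0\<close>] eq deg by (simp add: card_image inj_to_ac)
  show "range (to_ac :: 'k \<Rightarrow> _) \<subseteq> {z. z ^ ?q = z}"
    by (auto simp flip: to_ac_power simp: power_CARD)
qed

lemma finite_field_generator_bij:
  obtains g :: "'k :: {field, finite}"
  where "g \<noteq> 0" "bij_betw (\<lambda>k. g ^ k) {..<CARD('k) - 1} (UNIV - {0})"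
proof -
  interpret R: field "ring_of_type_algebra :: 'k ring" ..
  have R: "carrier (ring_of_type_algebra :: 'k ring) = UNIV"
    by (simp add: ring_of_type_algebra_def)
  have pow: "x [^]\<^bsub>(ring_of_type_algebra :: 'k ring)\<^esub> (k :: nat) = x ^ k" for x k
    by (induction k) (simp_all, simp_all add: ring_of_type_algebra_def)
  obtain g :: 'k where g: "g \<noteq> 0" "\<And>x. x \<noteq> 0 \<Longrightarrow> \<exists>k. x = g ^ k"
  proof -
    have "\<zero>\<^bsub>(ring_of_type_algebra :: 'k ring)\<^esub> = 0"
      by (simp add: ring_of_type_algebra_def)
    hence car: "carrier (Multiplicative_Group.mult_of (ring_of_type_algebra :: 'k ring)) = UNIV - {0}"
      by (simp add: R)
    have "\<exists>g \<in> UNIV - {0 :: 'k}. UNIV - {0} = {g ^ i | i :: nat. i \<in> UNIV}"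
      using R.finite_field_mult_group_has_gen unfolding car pow R by simp
    then obtain g :: 'k where "g \<in> UNIV - {0}" and "UNIV - {0} = {g ^ i | i :: nat. i \<in> UNIV}"
      by (elim bexE)
    thus ?thesis using that[of g] by blast
  qed
  let ?N = "CARD('k) - 1"
  have N: "?N > 0" using CARD_ge_2[where 'k = 'k] by simp
  have "(\<lambda>k. g ^ k) ` {..<?N} = UNIV - {0}"
  proof (intro equalityI subsetI)
    fix x :: 'k assume "x \<in> UNIV - {0}"
    then obtain k where "x = g ^ k" using g(2) by blast
    also have "g ^ k = g ^ (?N * (k div ?N) + k mod ?N)" by simp
    also have "\<dots> = g ^ (k mod ?N)"
      unfolding power_add power_mult using power_CARD_minus_1[OF g(1)] by simp
    finally show "x \<in> (\<lambda>k. g ^ k) ` {..<?N}" using N by auto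
  qed (use g in auto)
  moreover from this have "inj_on (\<lambda>k. g ^ k) {..<?N}"
    by (intro eq_card_imp_inj_on) (auto simp: card_Diff_singleton)
  ultimately show ?thesis using that g(1) by (auto simp: bij_betw_def)
qed

text \<open>
  Since \<open>q - 1\<close> is \<open>-1\<close> in the field, the exponent \<open>d\<close> is invertible there, which makes \<open>X\<^sup>d - t\<close>
  separable. The \<open>d\<close> roots of \<open>X\<^sup>d - 1\<close> in the closure are all fixed by Frobenius.
\<close>
lemma card_nth_roots_of_unity:
  assumes "d dvd CARD('k) - 1"
  shows "card {x :: 'k :: {field, finite}. x ^ d = 1} = d"
    and "\<And>t :: 'k. t \<noteq> 0 \<Longrightarrow> card {y. y ^ d = to_ac t} = d"
proof -
  have "(of_nat (CARD('k) - 1) :: 'k) = - 1"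
    using of_nat_CARD_eq_0[where 'k = 'k] CARD_ge_2[where 'k = 'k] by (simp add: of_nat_diff)
  hence "of_nat (CARD('k) - 1) \<noteq> (0 :: 'k)" by simp
  hence "of_nat d \<noteq> (0 :: 'k)" using assms by (metis dvd_def mult_eq_0_iff of_nat_mult)
  hence d: "of_nat d \<noteq> (0 :: 'k alg_closure)"
    by (metis to_ac_of_nat to_ac_eq_0_iff)
  show *: "card {y. y ^ d = to_ac t} = d" if "t \<noteq> 0" for t :: 'k
    using card_nth_roots_alg_closed[OF d] that by simp
  have "{y. y ^ d = to_ac (1 :: 'k)} = to_ac ` {x :: 'k. x ^ d = 1}"
  proof (intro equalityI subsetI)
    fix y :: "'k alg_closure" assume y: "y \<in> {y. y ^ d = to_ac 1}"
    obtain e where "CARD('k) - 1 = d * e" using assms by blast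
    hence "y ^ (CARD('k) - 1) = 1" using y by (simp add: power_mult)
    hence "y ^ CARD('k) = y"
      using CARD_ge_2[where 'k = 'k] by (cases "CARD('k)") auto
    then obtain x where "y = to_ac x" using range_to_ac_eq_frobenius_fixed[where 'k = 'k] by blast
    thus "y \<in> to_ac ` {x. x ^ d = 1}" using y by (auto simp flip: to_ac_power)
  qed (auto simp flip: to_ac_power)
  thus "card {x :: 'k. x ^ d = 1} = d"
    using *[of 1] by (simp add: card_image inj_on_subset[OF inj_to_ac])
qed

section \<open>Characters\<close>

lemma group_mult_grp: "Group.group (mult_grp :: 'a :: field monoid)"
proof (rule groupI)
  fix x :: 'a assume "x \<in> carrier mult_grp"
  thus "\<exists>y\<in>carrier mult_grp. y \<otimes>\<^bsub>mult_grp\<^esub> x = \<one>\<^bsub>mult_grp\<^esub>"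
    by (intro bexI[of _ "inverse x"]) auto
qed auto

lemma mu_simps [simp]:
  fixes x y :: "'a :: field"
  shows "carrier (mu d) = {x :: 'a. x ^ d = 1}" "x \<otimes>\<^bsub>mu d\<^esub> y = x * y" "\<one>\<^bsub>mu d\<^esub> = (1 :: 'a)"
  using mult_grp_simps(2)[of x y] mult_grp_simps(3)
  by (simp_all add: mu_def)

lemma group_mu:
  assumes "d > 0"
  shows "Group.group (mu d :: 'a :: field monoid)"
proof (rule groupI)
  fix x :: 'a assume x: "x \<in> carrier (mu d)"
  hence "x \<noteq> 0" using assms by (auto simp: power_0_left)
  with x show "\<exists>y\<in>carrier (mu d). y \<otimes>\<^bsub>mu d\<^esub> x = \<one>\<^bsub>mu d\<^esub>"
    by (intro bexI[of _ "inverse x"]) (auto simp: power_inverse)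
qed (auto simp: power_mult_distrib)

lemma char_group_simps [simp]:
  "(\<eta> \<otimes>\<^bsub>char_group G\<^esub> \<nu>) x = \<eta> x * \<nu> x"
  "\<one>\<^bsub>char_group G\<^esub> x = (if x \<in> carrier G then 1 else 0)"
  by (simp_all add: char_group_def)

lemma char_groupD:
  assumes "\<chi> \<in> carrier (char_group G)"
  shows "x \<in> carrier G \<Longrightarrow> \<chi> x \<noteq> 0"
    and "x \<notin> carrier G \<Longrightarrow> \<chi> x = 0"
    and "x \<in> carrier G \<Longrightarrow> y \<in> carrier G \<Longrightarrow> \<chi> (x \<otimes>\<^bsub>G\<^esub> y) = \<chi> x * \<chi> y"
  using assms by (auto simp: char_group_def hom_def Pi_def)

lemma char_group_inv_apply:
  assumes "Group.group G" and "\<chi> \<in> carrier (char_group G)"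
  shows "(inv\<^bsub>char_group G\<^esub> \<chi>) x = inverse (\<chi> x)"
proof (cases "x \<in> carrier G")
  case True
  interpret C: comm_group "char_group G" using assms(1) by (rule comm_group_char_group)
  have "(inv\<^bsub>char_group G\<^esub> \<chi> \<otimes>\<^bsub>char_group G\<^esub> \<chi>) x = \<one>\<^bsub>char_group G\<^esub> x"
    using assms(2) by (subst C.l_inv) auto
  with True have "(inv\<^bsub>char_group G\<^esub> \<chi>) x * \<chi> x = 1" by simp
  thus ?thesis by (metis inverse_unique mult.commute)
next
  case False
  interpret C: comm_group "char_group G" using assms(1) by (rule comm_group_char_group)
  show ?thesis
    using char_groupD(2)[OF C.inv_closed[OF assms(2)] False] char_groupD(2)[OF assms(2) False]
    by simp
qed

lemma char_group_pow_apply: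
  fixes k :: int
  assumes "Group.group G" and "\<chi> \<in> carrier (char_group G)" and "x \<in> carrier G"
  shows "(\<chi> [^]\<^bsub>char_group G\<^esub> k) x = \<chi> x powi k"
proof -
  interpret C: comm_group "char_group G" using assms(1) by (rule comm_group_char_group)
  have nat: "(\<chi> [^]\<^bsub>char_group G\<^esub> j) x = \<chi> x ^ j" for j :: nat
  proof (induction j)
    case 0
    show ?case using assms(3) by (simp only: C.nat_pow_0 char_group_simps power_0 if_True)
  next
    case (Suc j)
    thus ?case by (simp only: C.nat_pow_Suc char_group_simps power_Suc2)
  qed
  show ?thesis
  proof (cases "k < 0")
    case True
    hence "\<not> 0 \<le> k" by simp
    thus ?thesis
      using True char_group_inv_apply[OF assms(1) C.nat_pow_closed[OF assms(2)]]
      by (simp only: int_pow_def2 nat power_int_def power_inverse if_True if_False)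
  next
    case False
    hence "0 \<le> k" by simp
    thus ?thesis
      using False by (simp only: int_pow_def2 nat power_int_def if_True if_False)
  qed
qed

lemma char_group_finprod_apply:
  assumes "Group.group G" and "\<nu> \<in> A \<rightarrow> carrier (char_group G)" and "x \<in> carrier G"
  shows "finprod (char_group G) \<nu> A x = (\<Prod>i\<in>A. \<nu> i x)"
proof -
  interpret C: comm_group "char_group G" using assms(1) by (rule comm_group_char_group)
  show ?thesis
    using assms(2,3) by (induction A rule: infinite_finite_induct) (simp_all add: Pi_def)
qed

lemma mcharsI:
  assumes "\<nu> 0 = 0" and "\<And>x. x \<noteq> 0 \<Longrightarrow> \<nu> x \<noteq> 0"
    and "\<And>x y. x \<noteq> 0 \<Longrightarrow> y \<noteq> 0 \<Longrightarrow> \<nu> (x * y) = \<nu> x * \<nu> y"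
  shows "\<nu> \<in> carrier mchars"
  using assms by (auto simp: char_group_def hom_def)

text \<open>
  The convention \<open>\<nu> 0 = 0\<close> makes a multiplicative character multiplicative on all of the field,
  so the identities below carry no side conditions.
\<close>
lemma mchars_simps:
  assumes "\<nu> \<in> carrier (mchars :: ('k :: {field, finite} \<Rightarrow> qbar) monoid)"
  shows "\<nu> 0 = 0" "\<nu> x = 0 \<longleftrightarrow> x = 0" "\<nu> 1 = 1" "\<nu> (x * y) = \<nu> x * \<nu> y"
    "\<nu> (x ^ k) = \<nu> x ^ k" "\<nu> (inverse x) = inverse (\<nu> x)" "\<nu> (\<Prod>i\<in>A. f i) = (\<Prod>i\<in>A. \<nu> (f i))"
proof -
  note * = char_groupD[OF assms]
  show 0: "\<nu> 0 = 0" using *(2)[of 0] by simp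
  show eq_0: "\<nu> x = 0 \<longleftrightarrow> x = 0" for x using *(1)[of x] 0 by auto
  show mult: "\<nu> (x * y) = \<nu> x * \<nu> y" for x y
    using *(3)[of x y] 0 by (cases "x = 0"; cases "y = 0") auto
  show one: "\<nu> 1 = 1" using mult[of 1 1] eq_0[of 1] by simp
  show "\<nu> (x ^ k) = \<nu> x ^ k" by (induction k) (simp_all add: one mult)
  show "\<nu> (inverse x) = inverse (\<nu> x)"
    using mult[of x "inverse x"] 0 one
    by (cases "x = 0") (auto simp: inverse_unique)
  show "\<nu> (\<Prod>i\<in>A. f i) = (\<Prod>i\<in>A. \<nu> (f i))"
    by (induction A rule: infinite_finite_induct) (simp_all add: one mult)
qed

lemma mchars_mult_closed:
  "\<eta> \<in> carrier mchars \<Longrightarrow> \<nu> \<in> carrier mchars \<Longrightarrow> \<eta> \<otimes>\<^bsub>mchars\<^esub> \<nu> \<in> carrier mchars"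
  and mchars_one_closed: "\<one>\<^bsub>mchars\<^esub> \<in> carrier mchars"
  and mchars_inv_closed: "\<eta> \<in> carrier mchars \<Longrightarrow> inv\<^bsub>mchars\<^esub> \<eta> \<in> carrier mchars"
  and mchars_pow_closed: "\<eta> \<in> carrier mchars \<Longrightarrow> \<eta> [^]\<^bsub>mchars\<^esub> (k :: int) \<in> carrier mchars"
  and mchars_finprod_closed: "\<mu> \<in> A \<rightarrow> carrier mchars \<Longrightarrow> finprod mchars \<mu> A \<in> carrier mchars"
proof -
  interpret C: comm_group mchars by (rule comm_group_char_group[OF group_mult_grp])
  show "\<eta> \<in> carrier mchars \<Longrightarrow> \<nu> \<in> carrier mchars \<Longrightarrow> \<eta> \<otimes>\<^bsub>mchars\<^esub> \<nu> \<in> carrier mchars"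
    "\<one>\<^bsub>mchars\<^esub> \<in> carrier mchars"
    "\<eta> \<in> carrier mchars \<Longrightarrow> inv\<^bsub>mchars\<^esub> \<eta> \<in> carrier mchars"
    "\<eta> \<in> carrier mchars \<Longrightarrow> \<eta> [^]\<^bsub>mchars\<^esub> (k :: int) \<in> carrier mchars"
    "\<mu> \<in> A \<rightarrow> carrier mchars \<Longrightarrow> finprod mchars \<mu> A \<in> carrier mchars"
    by (auto intro: C.finprod_closed)
qed

lemma mchars_eqI:
  assumes "\<eta> \<in> carrier mchars" and "\<nu> \<in> carrier mchars" and "\<And>x. x \<noteq> 0 \<Longrightarrow> \<eta> x = \<nu> x"
  shows "\<eta> = \<nu>"
proof
  show "\<eta> x = \<nu> x" for x
    using assms(3)[of x] mchars_simps(1)[OF assms(1)] mchars_simps(1)[OF assms(2)]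
    by (cases "x = 0") auto
qed

lemma mchars_neq_one:
  assumes "\<eta> \<in> carrier mchars" and "\<eta> \<noteq> \<one>\<^bsub>mchars\<^esub>"
  obtains x where "x \<noteq> 0" "\<eta> x \<noteq> 1"
  using mchars_eqI[OF assms(1) mchars_one_closed] assms(2) by fastforce

text \<open>
  A character is determined by its value at a generator of the cyclic group of units, and
  every root of unity of the right order occurs as such a value.
\<close>
lemma mchars_eval_generator_bij:
  fixes g :: "'k :: {field, finite}"
  assumes g: "g \<noteq> 0" and bij: "bij_betw (\<lambda>k. g ^ k) {..<CARD('k) - 1} (UNIV - {0})"
  shows "bij_betw (\<lambda>\<nu>. \<nu> g) (carrier mchars) {z :: qbar. z ^ (CARD('k) - 1) = 1}"
proof -
  define N where "N = CARD('k) - 1"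
  have N: "N > 0" using CARD_ge_2[where 'k = 'k] by (simp add: N_def)
  have pw: "x ^ k = x ^ (k mod N)" if "x ^ N = 1" for x :: "'b :: field" and k
  proof -
    have "x ^ k = x ^ (N * (k div N) + k mod N)" by simp
    also have "\<dots> = x ^ (k mod N)" unfolding power_add power_mult that by simp
    finally show ?thesis .
  qed
  \<comment> \<open>the discrete logarithm to base \<open>g\<close>\<close>
  define lg where "lg = the_inv_into {..<N} (\<lambda>k. g ^ k)"
  have lg: "g ^ lg x = x" "lg x < N" if "x \<noteq> 0" for x
  proof -
    show "g ^ lg x = x"
      unfolding lg_def using bij that by (intro f_the_inv_into_f_bij_betw) (auto simp: N_def)
    show "lg x < N"
      using bij_betw_the_inv_into[OF bij] that unfolding lg_def N_def by (force simp: bij_betw_def)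
  qed
  have lg_unique: "lg (g ^ k) = k mod N" for k
  proof -
    have "g ^ k = g ^ (k mod N)" using power_CARD_minus_1[OF g] by (intro pw) (simp add: N_def)
    moreover have "k mod N \<in> {..<N}" using N by simp
    ultimately show ?thesis
      unfolding lg_def using bij by (simp add: the_inv_into_f_f bij_betw_def N_def)
  qed
  have lg_g: "z ^ lg g = z" if "z ^ N = 1" for z :: qbar
    using lg_unique[of 1] pw[OF that, of 1] by simp
  have lift: "(\<lambda>x. if x = 0 then 0 else z ^ lg x) \<in> carrier mchars" if z: "z ^ N = 1" for z :: qbar
  proof -
    have "lg (x * y) = (lg x + lg y) mod N" if "x \<noteq> 0" "y \<noteq> 0" for x y
    proof -
      have "x * y = g ^ (lg x + lg y)" using that by (simp add: power_add lg(1))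
      thus ?thesis using lg_unique by simp
    qed
    moreover have "z \<noteq> 0" using z N by (auto simp: power_0_left)
    ultimately show ?thesis
      using z by (intro mcharsI) (simp_all flip: power_add pw[OF z])
  qed
  show ?thesis unfolding N_def[symmetric]
  proof (rule bij_betw_byWitness[where f' = "\<lambda>z x. if x = 0 then 0 else z ^ lg x"])
    show "\<forall>\<nu>\<in>carrier mchars. (\<lambda>x. if x = 0 then 0 else \<nu> g ^ lg x) = \<nu>"
      by (auto simp: fun_eq_iff mchars_simps(1) lg simp flip: mchars_simps(5))
    show "\<forall>z\<in>{z :: qbar. z ^ N = 1}. (if g = 0 then 0 else z ^ lg g) = z"
      using lg_g g by simp
    show "(\<lambda>\<nu>. \<nu> g) ` carrier mchars \<subseteq> {z. z ^ N = 1}"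
      using power_CARD_minus_1[OF g]
      by (auto simp: mchars_simps(3) N_def simp flip: mchars_simps(5))
    show "(\<lambda>z x. if x = 0 then 0 else z ^ lg x) ` {z :: qbar. z ^ N = 1} \<subseteq> carrier mchars"
      using lift by (intro subsetI, elim imageE CollectE) simp
  qed
qed

lemma card_mchars: "card (carrier (mchars :: ('k :: {field, finite} \<Rightarrow> qbar) monoid)) = CARD('k) - 1"
proof -
  obtain g :: 'k where g: "g \<noteq> 0" "bij_betw (\<lambda>k. g ^ k) {..<CARD('k) - 1} (UNIV - {0})"
    by (rule finite_field_generator_bij)
  have "card {z :: qbar. z ^ (CARD('k) - 1) = 1} = CARD('k) - 1"
    using CARD_ge_2[where 'k = 'k] by (intro card_nth_roots_alg_closed) simp_all
  thus ?thesis using bij_betw_same_card[OF mchars_eval_generator_bij[OF g]] by simp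
qed

lemma finite_mchars: "finite (carrier (mchars :: ('k :: {field, finite} \<Rightarrow> qbar) monoid))"
  using CARD_ge_2[where 'k = 'k] by (intro card_ge_0_finite) (simp add: card_mchars)

text \<open>
  This separation of points is what orthogonality over the character group rests on. The witness
  takes a value at a generator that the exponent of \<open>x\<close> does not kill.
\<close>
lemma ex_mchar_neq_1:
  fixes x :: "'k :: {field, finite}"
  assumes "x \<noteq> 0" "x \<noteq> 1"
  shows "\<exists>\<nu>\<in>carrier mchars. \<nu> x \<noteq> 1"
proof -
  obtain g :: 'k where g: "g \<noteq> 0" "bij_betw (\<lambda>k. g ^ k) {..<CARD('k) - 1} (UNIV - {0})"
    by (rule finite_field_generator_bij)
  have "x \<in> (\<lambda>k. g ^ k) ` {..<CARD('k) - 1}"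
    using assms(1) by (subst bij_betw_imp_surj_on[OF g(2)]) simp
  then obtain k where k: "k < CARD('k) - 1" "x = g ^ k" by auto
  have "\<not> int (CARD('k) - 1) dvd int k"
  proof
    assume "int (CARD('k) - 1) dvd int k"
    hence "CARD('k) - 1 dvd k" by (simp only: int_dvd_int_iff)
    hence "k = 0" using k(1) by (auto dest: nat_dvd_not_less)
    thus False using assms(2) k by simp
  qed
  then obtain z :: qbar where z: "z ^ (CARD('k) - 1) = 1" "z powi int k \<noteq> 1"
    using ex_root_of_unity_power_neq_1[of "CARD('k) - 1" "int k"] k(1) by (metis gr_implies_not0 gr0I)
  have "z \<in> (\<lambda>\<nu>. \<nu> g) ` carrier mchars"
    using z(1) by (subst bij_betw_imp_surj_on[OF mchars_eval_generator_bij[OF g]]) simp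
  then obtain \<nu> where \<nu>: "\<nu> \<in> carrier mchars" "\<nu> g = z" by auto
  thus ?thesis using k(2) z(2) by (intro bexI[of _ \<nu>]) (auto simp: mchars_simps)
qed

lemma sum_over_mchars:
  fixes x :: "'k :: {field, finite}"
  assumes "x \<noteq> 0"
  shows "(\<Sum>\<nu>\<in>carrier mchars. \<nu> x) = (if x = 1 then of_nat CARD('k) - 1 else 0)"
proof (cases "x = 1")
  case True
  have "(\<Sum>\<nu>\<in>carrier mchars. \<nu> x) = (\<Sum>\<nu>\<in>carrier (mchars :: ('k \<Rightarrow> qbar) monoid). 1)"
    by (intro sum.cong) (auto simp: True mchars_simps)
  thus ?thesis using True CARD_ge_2[where 'k = 'k] by (simp add: card_mchars of_nat_diff)
next
  case False
  then obtain \<mu> where \<mu>: "\<mu> \<in> carrier mchars" "\<mu> x \<noteq> 1" using ex_mchar_neq_1[OF assms] by blast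
  interpret C: comm_group "mchars :: ('k \<Rightarrow> qbar) monoid"
    by (rule comm_group_char_group[OF group_mult_grp])
  have "(\<Sum>\<nu>\<in>carrier mchars. \<nu> x) = (\<Sum>\<nu>\<in>carrier mchars. (\<mu> \<otimes>\<^bsub>mchars\<^esub> \<nu>) x)"
    by (rule sum.reindex_bij_witness[of _ "\<lambda>\<nu>. \<mu> \<otimes>\<^bsub>mchars\<^esub> \<nu>" "\<lambda>\<nu>. inv\<^bsub>mchars\<^esub> \<mu> \<otimes>\<^bsub>mchars\<^esub> \<nu>"])
       (use \<mu>(1) in \<open>auto simp flip: C.m_assoc\<close>)
  also have "\<dots> = \<mu> x * (\<Sum>\<nu>\<in>carrier mchars. \<nu> x)" by (simp add: sum_distrib_left)
  finally show ?thesis using \<mu>(2) False by simp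
qed

lemma sum_mchar:
  assumes "\<nu> \<in> carrier mchars" and "\<nu> \<noteq> \<one>\<^bsub>mchars\<^esub>"
  shows "(\<Sum>x\<in>UNIV - {0}. \<nu> x) = 0"
proof -
  obtain a where a: "a \<noteq> 0" "\<nu> a \<noteq> 1" using assms by (rule mchars_neq_one)
  have "(\<Sum>x\<in>UNIV - {0}. \<nu> x) = (\<Sum>x\<in>UNIV - {0}. \<nu> (a * x))"
    by (rule sum.reindex_bij_witness[of _ "\<lambda>x. a * x" "\<lambda>x. x / a"]) (use a in auto)
  also have "\<dots> = \<nu> a * (\<Sum>x\<in>UNIV - {0}. \<nu> x)"
    by (simp add: mchars_simps[OF assms(1)] sum_distrib_left)
  finally show ?thesis using a(2) by simp
qed

lemma add_char_simps:
  assumes "\<psi> \<in> carrier (char_group (add_grp :: 'k :: {field, finite} monoid))"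
  shows "\<psi> (x + y) = \<psi> x * \<psi> y" "\<psi> 0 = 1" "\<psi> x \<noteq> 0" "\<psi> (\<Sum>i\<in>A. f i) = (\<Prod>i\<in>A. \<psi> (f i))"
proof -
  have car: "carrier (add_grp :: 'k monoid) = UNIV" "x \<otimes>\<^bsub>add_grp\<^esub> y = x + y" for x y :: 'k
    by (simp_all add: add_grp_def ring_of_type_algebra_def)
  show add: "\<psi> (x + y) = \<psi> x * \<psi> y" for x y
    using char_groupD(3)[OF assms, of x y] by (simp add: car)
  show ne: "\<psi> x \<noteq> 0" for x using char_groupD(1)[OF assms, of x] by (simp add: car)
  show z: "\<psi> 0 = 1" using add[of 0 0] ne[of 0] by simp
  show "\<psi> (\<Sum>i\<in>A. f i) = (\<Prod>i\<in>A. \<psi> (f i))"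
    by (induction A rule: infinite_finite_induct) (simp_all add: z add)
qed

lemma sum_add_char:
  assumes "\<psi> \<in> carrier (char_group (add_grp :: 'k :: {field, finite} monoid))"
    and "\<psi> \<noteq> \<one>\<^bsub>char_group add_grp\<^esub>"
  shows "(\<Sum>x\<in>UNIV - {0}. \<psi> (x * t)) = (if t = 0 then of_nat CARD('k) else 0) - 1"
proof -
  note \<psi> = add_char_simps[OF assms(1)]
  have "(\<Sum>x\<in>UNIV. \<psi> (x * t)) = (if t = 0 then of_nat CARD('k) else 0)"
  proof (cases "t = 0")
    case False
    have "carrier (add_grp :: 'k monoid) = UNIV"
      by (simp add: add_grp_def ring_of_type_algebra_def)
    then obtain a where a: "\<psi> a \<noteq> 1" using assms(2) by (auto simp: fun_eq_iff)
    have "(\<Sum>x\<in>UNIV. \<psi> (x * t)) = (\<Sum>x\<in>UNIV. \<psi> (a + x * t))"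
      by (rule sum.reindex_bij_witness[of _ "\<lambda>x. x + a / t" "\<lambda>x. x - a / t"])
         (use False in \<open>auto simp: field_simps\<close>)
    also have "\<dots> = \<psi> a * (\<Sum>x\<in>UNIV. \<psi> (x * t))" by (simp add: \<psi> sum_distrib_left)
    finally show ?thesis using a False by simp
  qed (simp add: \<psi>)
  moreover have "(\<Sum>x\<in>UNIV. \<psi> (x * t)) = \<psi> 0 + (\<Sum>x\<in>UNIV - {0}. \<psi> (x * t))"
    by (subst sum.remove[of _ 0]) simp_all
  ultimately show ?thesis by (simp add: \<psi> algebra_simps)
qed

section \<open>Gauss and Jacobi sums\<close>

text \<open>
  Substituting \<open>x = z t\<close> pulls out \<open>\<alpha> t\<close>. At \<open>t = 0\<close> the left side vanishes by orthogonality because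
  \<open>\<alpha>\<close> is non-trivial, and the right side because \<open>\<alpha> 0 = 0\<close>; this agreement is why the final formula
  needs no correction term on the locus where a linear form vanishes.
\<close>
lemma gauss_twist:
  assumes "\<alpha> \<in> carrier mchars" and "\<alpha> \<noteq> \<one>\<^bsub>mchars\<^esub>"
  shows "- (\<Sum>z\<in>UNIV - {0}. \<psi> (z * t) * \<alpha> z) = gauss \<psi> \<alpha> * inverse (\<alpha> t)"
proof (cases "t = 0")
  case True
  have "(\<Sum>z\<in>UNIV - {0}. \<psi> 0 * \<alpha> z) = \<psi> 0 * (\<Sum>z\<in>UNIV - {0}. \<alpha> z)"
    by (simp add: sum_distrib_left)
  thus ?thesis using True sum_mchar[OF assms] mchars_simps(1)[OF assms(1)] by simp
next
  case False
  have "(\<Sum>z\<in>UNIV - {0}. \<psi> (z * t) * \<alpha> z) = (\<Sum>x\<in>UNIV - {0}. \<psi> x * \<alpha> (x * inverse t))"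
    by (rule sum.reindex_bij_witness[of _ "\<lambda>x. x * inverse t" "\<lambda>z. z * t"])
       (use False in \<open>auto simp: mult.assoc\<close>)
  also have "\<dots> = (\<Sum>x\<in>UNIV - {0}. \<psi> x * \<alpha> x) * inverse (\<alpha> t)"
    by (simp add: mchars_simps[OF assms(1)] sum_distrib_right mult.assoc)
  finally show ?thesis by (simp add: gauss_def)
qed

context
  fixes \<psi> :: "'k :: {field, finite} \<Rightarrow> qbar"
  assumes \<psi>_char: "\<psi> \<in> carrier (char_group add_grp)"
    and \<psi>_nontrivial: "\<psi> \<noteq> \<one>\<^bsub>char_group add_grp\<^esub>"
begin

lemma gauss_one: "gauss \<psi> \<one>\<^bsub>mchars\<^esub> = 1"
  using sum_add_char[OF \<psi>_char \<psi>_nontrivial, of 1] by (simp add: gauss_def)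

text \<open>
  The classical \<open>g(\<nu>) g(\<nu>\<^sup>-\<^sup>1) = q \<nu>(-1)\<close> fails for the trivial character, where the product is \<open>1\<close>;
  the factor \<open>q\<close> built into \<open>gauss_circ\<close> repairs exactly this case. For non-trivial \<open>\<nu>\<close>, each
  term \<open>g(\<nu>) \<nu>(y)\<^sup>-\<^sup>1\<close> is written as a twisted Gauss sum and the sum over \<open>y\<close> is taken first.
\<close>
lemma gauss_reflection:
  assumes \<nu>: "\<nu> \<in> carrier mchars"
  shows "gauss \<psi> (inv\<^bsub>mchars\<^esub> \<nu>) * gauss_circ \<psi> \<nu> = of_nat CARD('k) * \<nu> (-1)"
proof (cases "\<nu> = \<one>\<^bsub>mchars\<^esub>")
  case True
  interpret C: comm_group "mchars :: ('k \<Rightarrow> qbar) monoid"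
    by (rule comm_group_char_group[OF group_mult_grp])
  show ?thesis by (simp add: True gauss_one gauss_circ_def char_delta_def)
next
  case False
  have inv: "(inv\<^bsub>mchars\<^esub> \<nu>) y = inverse (\<nu> y)" for y
    by (rule char_group_inv_apply[OF group_mult_grp \<nu>])
  have "gauss \<psi> (inv\<^bsub>mchars\<^esub> \<nu>) * gauss \<psi> \<nu> = (\<Sum>y\<in>UNIV - {0}. \<psi> y * (- (gauss \<psi> \<nu> * inverse (\<nu> y))))"
    by (simp add: gauss_def[of _ "inv\<^bsub>mchars\<^esub> \<nu>"] inv sum_distrib_left sum_distrib_right mult_ac sum_negf)
  also have "\<dots> = (\<Sum>y\<in>UNIV - {0}. \<psi> y * (\<Sum>z\<in>UNIV - {0}. \<psi> (z * y) * \<nu> z))"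
    by (simp flip: gauss_twist[OF \<nu> False])
  also have "\<dots> = (\<Sum>y\<in>UNIV - {0}. \<Sum>z\<in>UNIV - {0}. \<nu> z * \<psi> (y * (1 + z)))"
    by (simp add: sum_distrib_left add_char_simps(1)[OF \<psi>_char] distrib_left mult_ac)
  also have "\<dots> = (\<Sum>z\<in>UNIV - {0}. \<nu> z * (\<Sum>y\<in>UNIV - {0}. \<psi> (y * (1 + z))))"
    by (subst sum.swap) (simp add: sum_distrib_left)
  also have "\<dots> = (\<Sum>z\<in>UNIV - {0}. (if z = -1 then \<nu> z * of_nat CARD('k) else 0) - \<nu> z)"
    by (intro sum.cong refl, subst sum_add_char[OF \<psi>_char \<psi>_nontrivial])
       (auto simp: algebra_simps add_eq_0_iff minus_equation_iff[of _ 1])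
  also have "\<dots> = of_nat CARD('k) * \<nu> (-1)"
    by (simp add: sum_subtractf sum_mchar[OF \<nu> False])
  finally show ?thesis using False by (simp add: gauss_circ_def char_delta_def)
qed

lemma gauss_circ_neq_0: "\<nu> \<in> carrier mchars \<Longrightarrow> gauss_circ \<psi> \<nu> \<noteq> 0"
  and gauss_neq_0: "\<nu> \<in> carrier mchars \<Longrightarrow> gauss \<psi> \<nu> \<noteq> 0"
proof -
  show "gauss_circ \<psi> \<nu> \<noteq> 0" if "\<nu> \<in> carrier mchars"
    using gauss_reflection[OF that] mchars_simps(2)[OF that, of "-1"] by auto
  thus "gauss \<psi> \<nu> \<noteq> 0" if "\<nu> \<in> carrier mchars"
    using that by (auto simp: gauss_circ_def)
qed

text \<open>
  Fourier expansion of the additive character on the multiplicative group. By reflection,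
  \<open>q / gauss_circ \<psi> \<nu>\<close> is \<open>\<nu>(-1)\<close> times the Gauss sum of the inverse of \<open>\<nu>\<close>, whose defining sum
  is then collapsed by orthogonality in \<open>\<nu>\<close> to the single term at \<open>- t\<close>.
\<close>
lemma add_char_mchar_expansion:
  assumes "t \<noteq> 0"
  shows "of_nat CARD('k) * (\<Sum>\<nu>\<in>carrier mchars. \<nu> t / gauss_circ \<psi> \<nu>) = (1 - of_nat CARD('k)) * \<psi> (- t)"
proof -
  have "of_nat CARD('k) * (\<nu> t / gauss_circ \<psi> \<nu>) = - (\<Sum>y\<in>UNIV - {0}. \<psi> y * \<nu> (- t / y))"
    if \<nu>: "\<nu> \<in> carrier mchars" for \<nu>
  proof -
    have "\<nu> (-1) * \<nu> (-1) = 1"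
      using mchars_simps(3,4)[OF \<nu>] by (metis minus_mult_minus mult_1)
    hence "of_nat CARD('k) = gauss \<psi> (inv\<^bsub>mchars\<^esub> \<nu>) * gauss_circ \<psi> \<nu> * \<nu> (-1)"
      by (simp add: gauss_reflection[OF \<nu>])
    hence "of_nat CARD('k) * (\<nu> t / gauss_circ \<psi> \<nu>) = gauss \<psi> (inv\<^bsub>mchars\<^esub> \<nu>) * (\<nu> (-1) * \<nu> t)"
      using gauss_circ_neq_0[OF \<nu>] by simp
    also have "\<nu> (-1) * \<nu> t = \<nu> (- t)" by (simp flip: mchars_simps(4)[OF \<nu>])
    finally have reflected: "of_nat CARD('k) * (\<nu> t / gauss_circ \<psi> \<nu>) =
        gauss \<psi> (inv\<^bsub>mchars\<^esub> \<nu>) * \<nu> (- t)" .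
    have div: "\<nu> (- t / y) = \<nu> (- t) * inverse (\<nu> y)" for y
      by (simp only: divide_inverse mchars_simps(4,6)[OF \<nu>])
    show ?thesis
      unfolding reflected gauss_def div char_group_inv_apply[OF group_mult_grp \<nu>]
      by (simp only: sum_distrib_left mult_minus_right mult_ac)
  qed
  hence "of_nat CARD('k) * (\<Sum>\<nu>\<in>carrier mchars. \<nu> t / gauss_circ \<psi> \<nu>) =
      - (\<Sum>\<nu>\<in>carrier mchars. \<Sum>y\<in>UNIV - {0}. \<psi> y * \<nu> (- t / y))"
    by (simp add: sum_distrib_left flip: sum_negf)
  also have "\<dots> = - (\<Sum>y\<in>UNIV - {0}. \<psi> y * (\<Sum>\<nu>\<in>carrier mchars. \<nu> (- t / y)))"
    by (subst sum.swap) (simp add: sum_distrib_left)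
  also have "\<dots> = - (\<Sum>y\<in>UNIV - {0}. if y = - t then \<psi> y * (of_nat CARD('k) - 1) else 0)"
  proof (intro arg_cong[of _ _ uminus] sum.cong refl)
    fix y :: 'k assume "y \<in> UNIV - {0}"
    hence y: "y \<noteq> 0" by simp
    have nz: "- t / y \<noteq> 0" and one_iff: "- t / y = 1 \<longleftrightarrow> y = - t"
      using assms y by (simp, subst divide_eq_1_iff) auto
    show "\<psi> y * (\<Sum>\<nu>\<in>carrier mchars. \<nu> (- t / y)) = (if y = - t then \<psi> y * (of_nat CARD('k) - 1) else 0)"
      unfolding sum_over_mchars[OF nz] one_iff by simp
  qed
  also have "\<dots> = (1 - of_nat CARD('k)) * \<psi> (- t)" using assms by (simp add: algebra_simps)
  finally show ?thesis .
qed

text \<open>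
  The finite-field form of the multinomial expansion of \<open>(1 - \<Sum> u i)\<close> to the power \<open>-\<alpha>\<close>. Writing the
  Gauss sum of \<open>\<alpha> \<nu>\<close> out as a sum over \<open>z\<close> decouples the characters \<open>\<nu> i\<close>, so that the sum over
  each of them is the expansion of \<open>\<psi> (- z * u i)\<close>. What remains is the Gauss sum of \<open>\<alpha>\<close> twisted
  by \<open>1 - \<Sum> u i\<close>.
\<close>
lemma inverse_mchar_expansion:
  assumes I: "finite I" and \<alpha>: "\<alpha> \<in> carrier mchars" "\<alpha> \<noteq> \<one>\<^bsub>mchars\<^esub>"
    and u: "\<And>i. i \<in> I \<Longrightarrow> u i \<noteq> 0"
  shows "of_nat CARD('k) ^ card I * (\<Sum>\<nu>\<in>I \<rightarrow>\<^sub>E carrier mchars.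
      gauss \<psi> (\<alpha> \<otimes>\<^bsub>mchars\<^esub> finprod mchars \<nu> I) * (\<Prod>i\<in>I. \<nu> i (u i) / gauss_circ \<psi> (\<nu> i))) =
    (1 - of_nat CARD('k)) ^ card I * (gauss \<psi> \<alpha> * inverse (\<alpha> (1 - (\<Sum>i\<in>I. u i))))"
    (is "?q ^ _ * ?S = _")
proof -
  have "?S = (\<Sum>\<nu>\<in>I \<rightarrow>\<^sub>E carrier mchars. - (\<Sum>z\<in>UNIV - {0}. \<psi> z * \<alpha> z *
      (\<Prod>i\<in>I. \<nu> i (z * u i) / gauss_circ \<psi> (\<nu> i))))"
  proof (intro sum.cong refl)
    fix \<nu> :: "_ \<Rightarrow> 'k \<Rightarrow> qbar" assume \<nu>: "\<nu> \<in> I \<rightarrow>\<^sub>E carrier mchars"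
    have "finprod mchars \<nu> I z = (\<Prod>i\<in>I. \<nu> i z)" if "z \<noteq> 0" for z
      using that \<nu> by (intro char_group_finprod_apply[OF group_mult_grp]) auto
    hence "gauss \<psi> (\<alpha> \<otimes>\<^bsub>mchars\<^esub> finprod mchars \<nu> I) = - (\<Sum>z\<in>UNIV - {0}. \<psi> z * \<alpha> z * (\<Prod>i\<in>I. \<nu> i z))"
      by (simp add: gauss_def mult.assoc)
    moreover have "(\<Prod>i\<in>I. \<nu> i (z * u i) / gauss_circ \<psi> (\<nu> i)) =
        (\<Prod>i\<in>I. \<nu> i z) * (\<Prod>i\<in>I. \<nu> i (u i) / gauss_circ \<psi> (\<nu> i))" for z
    proof -
      have "(\<Prod>i\<in>I. \<nu> i (z * u i) / gauss_circ \<psi> (\<nu> i)) =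
          (\<Prod>i\<in>I. \<nu> i z * (\<nu> i (u i) / gauss_circ \<psi> (\<nu> i)))"
        by (intro prod.cong refl) (simp add: mchars_simps(4)[OF PiE_mem[OF \<nu>]])
      thus ?thesis by (simp only: prod.distrib)
    qed
    ultimately show "gauss \<psi> (\<alpha> \<otimes>\<^bsub>mchars\<^esub> finprod mchars \<nu> I) * (\<Prod>i\<in>I. \<nu> i (u i) / gauss_circ \<psi> (\<nu> i)) =
        - (\<Sum>z\<in>UNIV - {0}. \<psi> z * \<alpha> z * (\<Prod>i\<in>I. \<nu> i (z * u i) / gauss_circ \<psi> (\<nu> i)))"
      by (simp only: sum_distrib_right mult_minus_left mult.assoc)
  qed
  also have "\<dots> = - (\<Sum>z\<in>UNIV - {0}. \<psi> z * \<alpha> z *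
      (\<Sum>\<nu>\<in>I \<rightarrow>\<^sub>E carrier mchars. \<Prod>i\<in>I. \<nu> i (z * u i) / gauss_circ \<psi> (\<nu> i)))"
    unfolding sum_negf by (subst sum.swap) (simp only: sum_distrib_left)
  also have "\<dots> = - (\<Sum>z\<in>UNIV - {0}. \<psi> z * \<alpha> z *
      (\<Prod>i\<in>I. \<Sum>\<nu>\<in>carrier mchars. \<nu> (z * u i) / gauss_circ \<psi> \<nu>))"
    by (subst prod_sum_PiE[OF I finite_mchars]) (rule refl)
  finally have S: "?S = \<dots>" .
  have pull: "(\<Prod>i\<in>I. ?q * f i) = ?q ^ card I * (\<Prod>i\<in>I. f i)" for f
    by (simp add: prod.distrib)
  have "?q ^ card I * ?S = - (\<Sum>z\<in>UNIV - {0}. \<psi> z * \<alpha> z *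
      (\<Prod>i\<in>I. ?q * (\<Sum>\<nu>\<in>carrier mchars. \<nu> (z * u i) / gauss_circ \<psi> \<nu>)))"
    unfolding S pull by (simp only: sum_distrib_left[of "?q ^ card I"] mult_minus_right mult_ac)
  also have "\<dots> = - (\<Sum>z\<in>UNIV - {0}. \<psi> z * \<alpha> z * (\<Prod>i\<in>I. (1 - ?q) * \<psi> (- (z * u i))))"
    using u by (intro arg_cong[of _ _ uminus] sum.cong prod.cong refl arg_cong2[of _ _ _ _ "(*)"]
      add_char_mchar_expansion) auto
  also have "\<dots> = - (\<Sum>z\<in>UNIV - {0}. (1 - ?q) ^ card I * (\<psi> (z * (1 - (\<Sum>i\<in>I. u i))) * \<alpha> z))"
  proof (intro arg_cong[of _ _ uminus] sum.cong refl)
    fix z :: 'k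
    have "z * (1 - (\<Sum>i\<in>I. u i)) = z + (\<Sum>i\<in>I. - (z * u i))"
      by (simp add: sum_negf sum_distrib_left right_diff_distrib)
    hence "\<psi> (z * (1 - (\<Sum>i\<in>I. u i))) = \<psi> z * (\<Prod>i\<in>I. \<psi> (- (z * u i)))"
      by (simp only: add_char_simps[OF \<psi>_char])
    thus "\<psi> z * \<alpha> z * (\<Prod>i\<in>I. (1 - ?q) * \<psi> (- (z * u i))) =
        (1 - ?q) ^ card I * (\<psi> (z * (1 - (\<Sum>i\<in>I. u i))) * \<alpha> z)"
      by (simp add: prod.distrib)
  qed
  also have "\<dots> = (1 - ?q) ^ card I * (- (\<Sum>z\<in>UNIV - {0}. \<psi> (z * (1 - (\<Sum>i\<in>I. u i))) * \<alpha> z))"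
    by (simp only: sum_distrib_left mult_minus_right)
  also have "\<dots> = (1 - ?q) ^ card I * (gauss \<psi> \<alpha> * inverse (\<alpha> (1 - (\<Sum>i\<in>I. u i))))"
    by (simp only: gauss_twist[OF \<alpha>])
  finally show ?thesis .
qed

text \<open>
  Expanding the product of Gauss sums and sorting by the value \<open>t\<close> of the sum of the variables
  gives, by homogeneity, the Jacobi sum times a Gauss sum, plus the contribution of \<open>t = 0\<close>. The
  latter is found from the fact that the unweighted total vanishes as soon as one character is
  non-trivial. It is zero unless the product character is trivial, and then it supplies
  the missing factor \<open>q\<close> in \<open>gauss_circ\<close>.
\<close>
lemma jacobi_gauss_circ:
  assumes k: "k > 0" and \<eta>: "\<And>i. i \<in> {1..k} \<Longrightarrow> \<eta> i \<in> carrier mchars"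
    and nontriv: "\<exists>i\<in>{1..k}. \<eta> i \<noteq> \<one>\<^bsub>mchars\<^esub>"
  shows "jacobi k \<eta> * gauss_circ \<psi> (finprod mchars \<eta> {1..k}) = (\<Prod>i=1..k. gauss \<psi> (\<eta> i))"
proof -
  define P :: "(nat \<Rightarrow> 'k) set" where "P = {1..k} \<rightarrow>\<^sub>E UNIV - {0}"
  define w where "w x = (\<Prod>i=1..k. \<eta> i (x i))" for x :: "nat \<Rightarrow> 'k"
  \<comment> \<open>the slice \<open>t\<close> of the total sum; \<open>S 1\<close> is the Jacobi sum up to sign\<close>
  define S where "S t = (\<Sum>x | x \<in> P \<and> (\<Sum>i=1..k. x i) = t. w x)" for t
  define \<kappa> where "\<kappa> = finprod mchars \<eta> {1..k}"
  have fin: "finite P" by (simp add: P_def finite_PiE)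
  have \<kappa>_in: "\<kappa> \<in> carrier mchars"
    unfolding \<kappa>_def using \<eta> by (intro mchars_finprod_closed) auto
  have \<kappa>: "\<kappa> t = (\<Prod>i=1..k. \<eta> i t)" if "t \<noteq> 0" for t
    unfolding \<kappa>_def using \<eta> that by (intro char_group_finprod_apply[OF group_mult_grp]) auto
  have fibres: "(\<Sum>x\<in>P. f (\<Sum>i=1..k. x i) * w x) = f 0 * S 0 + (\<Sum>t\<in>UNIV - {0}. f t * S t)"
    for f :: "'k \<Rightarrow> qbar"
  proof -
    have "(\<Sum>x\<in>P. f (\<Sum>i=1..k. x i) * w x) =
        (\<Sum>t\<in>UNIV. \<Sum>x | x \<in> P \<and> (\<Sum>i=1..k. x i) = t. f (\<Sum>i=1..k. x i) * w x)"
      by (rule sum.group[symmetric]) (use fin in auto)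
    also have "\<dots> = (\<Sum>t\<in>UNIV. f t * S t)"
      by (simp add: S_def sum_distrib_left)
    also have "\<dots> = f 0 * S 0 + (\<Sum>t\<in>UNIV - {0}. f t * S t)"
      by (rule sum.remove) auto
    finally show ?thesis .
  qed
  have scale: "S t = \<kappa> t * S 1" if t: "t \<noteq> 0" for t
  proof -
    have "\<kappa> t * S 1 = (\<Sum>x | x \<in> P \<and> (\<Sum>i=1..k. x i) = 1. \<kappa> t * w x)"
      by (simp add: S_def sum_distrib_left)
    also have "\<dots> = S t" unfolding S_def
    proof (rule sum.reindex_bij_witness[of _ "\<lambda>x. \<lambda>i\<in>{1..k}. x i / t" "\<lambda>x. \<lambda>i\<in>{1..k}. t * x i"])
      fix x assume x: "x \<in> {x \<in> P. (\<Sum>i=1..k. x i) = 1}"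
      have "w (\<lambda>i\<in>{1..k}. t * x i) = (\<Prod>i=1..k. \<eta> i t * \<eta> i (x i))"
        unfolding w_def by (intro prod.cong refl) (simp add: mchars_simps(4)[OF \<eta>])
      also have "\<dots> = \<kappa> t * w x" by (simp add: \<kappa>[OF t] w_def prod.distrib)
      finally show "w (\<lambda>i\<in>{1..k}. t * x i) = \<kappa> t * w x" .
    qed (use t in \<open>auto simp: P_def fun_eq_iff PiE_def extensional_def simp flip: sum_distrib_left sum_divide_distrib\<close>)
    finally show ?thesis by simp
  qed
  have "(\<Prod>i=1..k. gauss \<psi> (\<eta> i)) = (\<Prod>i=1..k. \<Sum>x\<in>UNIV - {0}. - (\<psi> x * \<eta> i x))"
    by (simp add: gauss_def sum_negf)
  also have "\<dots> = (\<Sum>x\<in>P. \<Prod>i=1..k. - (\<psi> (x i) * \<eta> i (x i)))"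
    unfolding P_def by (rule prod_sum_PiE) auto
  also have "\<dots> = (\<Sum>x\<in>P. (-1) ^ k * (\<psi> (\<Sum>i=1..k. x i) * w x))"
    by (simp add: w_def add_char_simps(4)[OF \<psi>_char] prod.distrib prod_uminus)
  also have "\<dots> = (-1) ^ k * (\<psi> 0 * S 0 + (\<Sum>t\<in>UNIV - {0}. \<psi> t * S t))"
    by (simp only: sum_distrib_left[symmetric] fibres)
  also have "(\<Sum>t\<in>UNIV - {0}. \<psi> t * S t) = - gauss \<psi> \<kappa> * S 1"
  proof -
    have "(\<Sum>t\<in>UNIV - {0}. \<psi> t * S t) = (\<Sum>t\<in>UNIV - {0}. \<psi> t * \<kappa> t * S 1)"
      by (intro sum.cong refl) (metis DiffD2 mult.assoc scale singletonI)
    thus ?thesis by (simp add: gauss_def sum_distrib_right)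
  qed
  finally have gauss_prod: "(\<Prod>i=1..k. gauss \<psi> (\<eta> i)) = (-1) ^ k * (S 0 - gauss \<psi> \<kappa> * S 1)"
    by (simp add: add_char_simps(2)[OF \<psi>_char])
  have "(\<Prod>i=1..k. \<Sum>x\<in>UNIV - {0}. \<eta> i x) = 0"
  proof -
    obtain i where "i \<in> {1..k}" "\<eta> i \<noteq> \<one>\<^bsub>mchars\<^esub>" using nontriv by blast
    thus ?thesis using sum_mchar[OF \<eta>] by (intro prod_zero bexI[of _ i]) auto
  qed
  hence "(\<Sum>x\<in>P. w x) = 0"
    unfolding P_def w_def by (subst (asm) prod_sum_PiE) auto
  hence total: "S 0 + (\<Sum>t\<in>UNIV - {0}. \<kappa> t) * S 1 = 0"
  proof -
    have "(\<Sum>t\<in>UNIV - {0}. S t) = (\<Sum>t\<in>UNIV - {0}. \<kappa> t * S 1)"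
      by (intro sum.cong refl) (metis DiffD2 scale singletonI)
    thus ?thesis using fibres[of "\<lambda>_. 1"] \<open>(\<Sum>x\<in>P. w x) = 0\<close> by (simp add: sum_distrib_right)
  qed
  have "gauss_circ \<psi> \<kappa> * S 1 = gauss \<psi> \<kappa> * S 1 - S 0"
  proof (cases "\<kappa> = \<one>\<^bsub>mchars\<^esub>")
    case True
    have "(\<Sum>t\<in>UNIV - {0}. \<kappa> t) = of_nat CARD('k) - 1"
      using CARD_ge_2[where 'k = 'k] by (simp add: True card_Diff_singleton of_nat_diff)
    with total have "S 0 = - (of_nat CARD('k) - 1) * S 1"
      by (simp add: eq_neg_iff_add_eq_0 algebra_simps)
    thus ?thesis using True by (simp add: gauss_circ_def char_delta_def gauss_one algebra_simps)
  next
    case False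
    thus ?thesis using total sum_mchar[OF \<kappa>_in False] by (simp add: gauss_circ_def char_delta_def)
  qed
  moreover have "jacobi k \<eta> = (-1) ^ (k - 1) * S 1"
    by (simp add: jacobi_def S_def P_def w_def)
  ultimately have "jacobi k \<eta> * gauss_circ \<psi> \<kappa> = (-1) ^ (k - 1) * (gauss \<psi> \<kappa> * S 1 - S 0)"
    by (simp add: mult_ac)
  also have "\<dots> = (-1) ^ k * (S 0 - gauss \<psi> \<kappa> * S 1)"
    using k by (cases k) (simp_all add: algebra_simps)
  finally show ?thesis by (simp only: gauss_prod \<kappa>_def)
qed

end

text \<open>
  The last variable is eliminated. It had to be non-zero, a condition that \<open>\<eta> 0 = 0\<close> enforces
  by itself.
\<close>
lemma jacobi_affine:
  fixes \<beta> :: "nat \<Rightarrow> 'k :: {field, finite} \<Rightarrow> qbar"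
  assumes \<eta>: "\<eta> 0 = 0"
  shows "jacobi (n + 1) (\<lambda>i. if i \<le> n then \<beta> i else \<eta>) =
    (-1) ^ n * (\<Sum>x\<in>{1..n} \<rightarrow>\<^sub>E UNIV - {0}. (\<Prod>i=1..n. \<beta> i (x i)) * \<eta> (1 - (\<Sum>i=1..n. x i)))"
proof -
  let ?P = "{1..n} \<rightarrow>\<^sub>E UNIV - {0 :: 'k}"
  have "(\<Sum>x | x \<in> {1..n + 1} \<rightarrow>\<^sub>E UNIV - {0} \<and> (\<Sum>i=1..n + 1. x i) = 1.
      \<Prod>i=1..n + 1. (if i \<le> n then \<beta> i else \<eta>) (x i)) =
    (\<Sum>x\<in>{x \<in> ?P. 1 - (\<Sum>i=1..n. x i) \<noteq> 0}. (\<Prod>i=1..n. \<beta> i (x i)) * \<eta> (1 - (\<Sum>i=1..n. x i)))"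
  proof (rule sum.reindex_bij_witness[of _ "\<lambda>x. x(n + 1 := 1 - (\<Sum>i=1..n. x i))" "\<lambda>x. restrict x {1..n}"])
    fix x :: "nat \<Rightarrow> 'k" assume x: "x \<in> {x. x \<in> {1..n + 1} \<rightarrow>\<^sub>E UNIV - {0} \<and> (\<Sum>i=1..n + 1. x i) = 1}"
    hence last: "1 - (\<Sum>i=1..n. x i) = x (n + 1)" by (auto simp: algebra_simps)
    thus "(restrict x {1..n})(n + 1 := 1 - (\<Sum>i=1..n. restrict x {1..n} i)) = x"
      using x by (auto simp: fun_eq_iff PiE_def extensional_def)
    have "x (n + 1) \<noteq> 0" using x by (auto dest: PiE_mem[of _ _ _ "n + 1"])
    thus "restrict x {1..n} \<in> {x \<in> ?P. 1 - (\<Sum>i=1..n. x i) \<noteq> 0}"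
      using x last by (auto simp: PiE_def Pi_def)
    have "(\<Prod>i=1..n. (if i \<le> n then \<beta> i else \<eta>) (x i)) = (\<Prod>i=1..n. \<beta> i (x i))"
      by (intro prod.cong) auto
    thus "(\<Prod>i=1..n. \<beta> i (restrict x {1..n} i)) * \<eta> (1 - (\<Sum>i=1..n. restrict x {1..n} i)) =
        (\<Prod>i=1..n + 1. (if i \<le> n then \<beta> i else \<eta>) (x i))"
      using last by simp
  next
    fix x :: "nat \<Rightarrow> 'k" assume x: "x \<in> {x \<in> ?P. 1 - (\<Sum>i=1..n. x i) \<noteq> 0}"
    show "restrict (x(n + 1 := 1 - (\<Sum>i=1..n. x i))) {1..n} = x"
      using x by (auto simp: fun_eq_iff PiE_def extensional_def)
    show "x(n + 1 := 1 - (\<Sum>i=1..n. x i)) \<in>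
        {x. x \<in> {1..n + 1} \<rightarrow>\<^sub>E UNIV - {0} \<and> (\<Sum>i=1..n + 1. x i) = 1}"
      using x by (auto simp: PiE_def Pi_def extensional_def)
  qed
  also have "\<dots> = (\<Sum>x\<in>?P. (\<Prod>i=1..n. \<beta> i (x i)) * \<eta> (1 - (\<Sum>i=1..n. x i)))"
    using \<eta> by (intro sum.mono_neutral_left) (auto simp: finite_PiE)
  finally show ?thesis by (simp add: jacobi_def)
qed

section \<open>The Lauricella function as a character sum\<close>

text \<open>
  The analogue of Euler's integral representation, with the Jacobi sum in the role of the beta
  function that normalises the integral. In each term of the series, the Gauss sums of the
  parameters combine with the leading Jacobi sum into the Jacobi sum of the shifted parameters
  \<open>\<beta> i \<nu> i\<close>. Opened up as a sum over \<open>x\<close>, it contributes \<open>\<nu> i (x i)\<close>, and the series in \<open>\<nu>\<close>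
  becomes the multinomial expansion at \<open>u i = l i * x i\<close>. That the last character \<open>\<eta>\<close> is non-trivial
  guarantees that the factorisation into Gauss sums is valid for all shifts at once.
\<close>
lemma jacobi_times_lauricella_FD:
  fixes \<psi> :: "'k :: {field, finite} \<Rightarrow> qbar"
  assumes \<psi>: "\<psi> \<in> carrier (char_group add_grp)" "\<psi> \<noteq> \<one>\<^bsub>char_group add_grp\<^esub>"
    and \<alpha>: "\<alpha> \<in> carrier mchars" "\<alpha> \<noteq> \<one>\<^bsub>mchars\<^esub>"
    and \<beta>: "\<And>i. i \<in> {1..n} \<Longrightarrow> \<beta> i \<in> carrier mchars"
    and \<eta>: "\<eta> \<in> carrier mchars" "\<eta> \<noteq> \<one>\<^bsub>mchars\<^esub>"
    and l: "\<And>i. i \<in> {1..n} \<Longrightarrow> l i \<noteq> 0"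
  shows "jacobi (n + 1) (\<lambda>i. if i \<le> n then \<beta> i else \<eta>) *
      lauricella_FD \<psi> n \<alpha> \<beta> (finprod mchars \<beta> {1..n} \<otimes>\<^bsub>mchars\<^esub> \<eta>) l =
    (-1) ^ n * (\<Sum>x\<in>{1..n} \<rightarrow>\<^sub>E UNIV - {0}.
      inverse (\<alpha> (1 - (\<Sum>i=1..n. l i * x i))) * ((\<Prod>i=1..n. \<beta> i (x i)) * \<eta> (1 - (\<Sum>i=1..n. x i))))"
    (is "?J * ?F = _ * (\<Sum>x\<in>?P. inverse (\<alpha> (?A x)) * (?B x * ?C x))")
proof -
  interpret M: comm_group "mchars :: ('k \<Rightarrow> qbar) monoid"
    by (rule comm_group_char_group[OF group_mult_grp])
  define q :: qbar where "q = of_nat CARD('k)"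
  have q: "q \<noteq> 0" "1 - q \<noteq> 0"
    using CARD_ge_2[where 'k = 'k] of_nat_eq_1_iff[of "CARD('k)", where 'a = qbar]
    by (auto simp: q_def)
  define \<gamma> where "\<gamma> = finprod mchars \<beta> {1..n} \<otimes>\<^bsub>mchars\<^esub> \<eta>"
  have \<gamma>_in: "\<gamma> \<in> carrier mchars"
    unfolding \<gamma>_def using \<beta> \<eta>(1) by (intro mchars_mult_closed mchars_finprod_closed) auto
  have jacobi_eq: "jacobi (n + 1) (\<lambda>i. if i \<le> n then \<delta> i else \<eta>) =
      (\<Prod>i=1..n. gauss \<psi> (\<delta> i)) * gauss \<psi> \<eta> / gauss_circ \<psi> (finprod mchars \<delta> {1..n} \<otimes>\<^bsub>mchars\<^esub> \<eta>)"
    if \<delta>: "\<And>i. i \<in> {1..n} \<Longrightarrow> \<delta> i \<in> carrier mchars" for \<delta>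
  proof -
    define \<delta>' where "\<delta>' = (\<lambda>i. if i \<le> n then \<delta> i else \<eta>)"
    have \<delta>': "\<delta>' i \<in> carrier mchars" if "i \<in> {1..n + 1}" for i
      using that \<delta> \<eta>(1) by (auto simp: \<delta>'_def)
    have "finprod mchars \<delta>' {1..n + 1} = finprod mchars \<delta> {1..n} \<otimes>\<^bsub>mchars\<^esub> \<eta>"
    proof (rule mchars_eqI)
      fix x :: 'k assume x: "x \<noteq> 0"
      have "finprod mchars \<delta>' {1..n + 1} x = (\<Prod>i=1..n + 1. \<delta>' i x)"
        using x \<delta>' by (intro char_group_finprod_apply[OF group_mult_grp]) auto
      also have "\<dots> = (\<Prod>i=1..n. \<delta> i x) * \<eta> x"
        by (simp add: \<delta>'_def)
      also have "(\<Prod>i=1..n. \<delta> i x) = finprod mchars \<delta> {1..n} x"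
        using x \<delta> by (intro char_group_finprod_apply[OF group_mult_grp, symmetric]) auto
      finally show "finprod mchars \<delta>' {1..n + 1} x = (finprod mchars \<delta> {1..n} \<otimes>\<^bsub>mchars\<^esub> \<eta>) x"
        by simp
    qed (use \<delta> \<delta>' \<eta>(1) in \<open>auto intro!: mchars_mult_closed mchars_finprod_closed\<close>)
    moreover have "jacobi (n + 1) \<delta>' * gauss_circ \<psi> (finprod mchars \<delta>' {1..n + 1}) =
        (\<Prod>i=1..n + 1. gauss \<psi> (\<delta>' i))"
    proof (rule jacobi_gauss_circ[OF \<psi>])
      show "\<exists>i\<in>{1..n + 1}. \<delta>' i \<noteq> \<one>\<^bsub>mchars\<^esub>"
        using \<eta>(2) by (intro bexI[of _ "n + 1"]) (auto simp: \<delta>'_def)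
    qed (use \<delta>' in auto)
    moreover have "(\<Prod>i=1..n + 1. gauss \<psi> (\<delta>' i)) = (\<Prod>i=1..n. gauss \<psi> (\<delta> i)) * gauss \<psi> \<eta>"
      by (simp add: \<delta>'_def)
    moreover have "gauss_circ \<psi> (finprod mchars \<delta> {1..n} \<otimes>\<^bsub>mchars\<^esub> \<eta>) \<noteq> 0"
      using \<delta> \<eta>(1) by (intro gauss_circ_neq_0[OF \<psi>] mchars_mult_closed mchars_finprod_closed) auto
    ultimately show ?thesis by (simp add: \<delta>'_def field_simps)
  qed
  have summand: "?J * ((poch \<psi> \<alpha> (finprod mchars \<nu> {1..n}) * (\<Prod>i=1..n. poch \<psi> (\<beta> i) (\<nu> i))) /
       (poch_circ \<psi> \<gamma> (finprod mchars \<nu> {1..n}) * (\<Prod>i=1..n. poch_circ \<psi> \<one>\<^bsub>mchars\<^esub> (\<nu> i))) *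
       (\<Prod>i=1..n. \<nu> i (l i))) =
     (\<Sum>x\<in>?P. (-1) ^ n * q ^ n / gauss \<psi> \<alpha> * (?B x * ?C x) *
       (gauss \<psi> (\<alpha> \<otimes>\<^bsub>mchars\<^esub> finprod mchars \<nu> {1..n}) * (\<Prod>i=1..n. \<nu> i (l i * x i) / gauss_circ \<psi> (\<nu> i))))"
    if "\<nu> \<in> {1..n} \<rightarrow>\<^sub>E carrier mchars" for \<nu>
  proof -
    have \<nu>: "\<nu> i \<in> carrier mchars" if "i \<in> {1..n}" for i
      using \<open>\<nu> \<in> _\<close> that by auto
    define \<tau> where "\<tau> = finprod mchars \<nu> {1..n}"
    define \<delta> where "\<delta> = (\<lambda>i. \<beta> i \<otimes>\<^bsub>mchars\<^esub> \<nu> i)"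
    have \<delta>: "\<delta> i \<in> carrier mchars" if "i \<in> {1..n}" for i
      using that \<beta> \<nu> by (simp add: \<delta>_def mchars_mult_closed)
    have "finprod mchars \<delta> {1..n} = finprod mchars \<beta> {1..n} \<otimes>\<^bsub>mchars\<^esub> \<tau>"
      unfolding \<delta>_def \<tau>_def using \<beta> \<nu> by (intro M.finprod_multf) auto
    hence \<gamma>\<tau>: "finprod mchars \<delta> {1..n} \<otimes>\<^bsub>mchars\<^esub> \<eta> = \<gamma> \<otimes>\<^bsub>mchars\<^esub> \<tau>"
      by (simp add: \<gamma>_def char_group_def mult_ac)
    have \<tau>_in: "\<tau> \<in> carrier mchars"
      unfolding \<tau>_def using \<nu> by (intro mchars_finprod_closed) auto
    have "gauss_circ \<psi> \<one>\<^bsub>mchars\<^esub> = q"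
      by (simp add: gauss_circ_def char_delta_def gauss_one[OF \<psi>] q_def)
    hence "(\<Prod>i=1..n. poch_circ \<psi> \<one>\<^bsub>mchars\<^esub> (\<nu> i)) = (\<Prod>i=1..n. gauss_circ \<psi> (\<nu> i) / q)"
      by (intro prod.cong refl) (simp add: poch_circ_def M.l_one[OF \<nu>])
    hence p_one: "(\<Prod>i=1..n. poch_circ \<psi> \<one>\<^bsub>mchars\<^esub> (\<nu> i)) = (\<Prod>i=1..n. gauss_circ \<psi> (\<nu> i)) / q ^ n"
      by (simp add: prod_dividef)
    have p_\<beta>: "(\<Prod>i=1..n. poch \<psi> (\<beta> i) (\<nu> i)) =
        (\<Prod>i=1..n. gauss \<psi> (\<delta> i)) / (\<Prod>i=1..n. gauss \<psi> (\<beta> i))"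
      by (simp add: poch_def \<delta>_def prod_dividef)
    have nz: "gauss_circ \<psi> \<gamma> \<noteq> 0" "gauss_circ \<psi> (\<gamma> \<otimes>\<^bsub>mchars\<^esub> \<tau>) \<noteq> 0" "gauss \<psi> \<alpha> \<noteq> 0"
      "(\<Prod>i=1..n. gauss \<psi> (\<beta> i)) \<noteq> 0" "(\<Prod>i=1..n. gauss_circ \<psi> (\<nu> i)) \<noteq> 0"
      using \<gamma>_in \<tau>_in \<alpha>(1) \<beta> \<nu>
      by (auto simp: gauss_circ_neq_0[OF \<psi>] gauss_neq_0[OF \<psi>] mchars_mult_closed)
    have field: "b * e / c * (GA / a * (Gb / b) / (Gc / c * (D / Q)) * L) = Q * GA / a * (L / D) * (Gb * e / Gc)"
      if "a \<noteq> 0" "b \<noteq> 0" "c \<noteq> 0" "D \<noteq> 0" "Gc \<noteq> 0" for a b c D e Q GA Gb Gc L :: qbar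
      using that by (simp add: field_simps)
    have jacobi_\<beta>: "?J = (\<Prod>i=1..n. gauss \<psi> (\<beta> i)) * gauss \<psi> \<eta> / gauss_circ \<psi> \<gamma>"
      unfolding \<gamma>_def by (rule jacobi_eq) (rule \<beta>)
    have jacobi_\<delta>: "jacobi (n + 1) (\<lambda>i. if i \<le> n then \<delta> i else \<eta>) =
        (\<Prod>i=1..n. gauss \<psi> (\<delta> i)) * gauss \<psi> \<eta> / gauss_circ \<psi> (\<gamma> \<otimes>\<^bsub>mchars\<^esub> \<tau>)"
      unfolding \<gamma>\<tau>[symmetric] by (rule jacobi_eq) (rule \<delta>)
    have "?J * ((poch \<psi> \<alpha> \<tau> * (\<Prod>i=1..n. poch \<psi> (\<beta> i) (\<nu> i))) /
         (poch_circ \<psi> \<gamma> \<tau> * (\<Prod>i=1..n. poch_circ \<psi> \<one>\<^bsub>mchars\<^esub> (\<nu> i))) * (\<Prod>i=1..n. \<nu> i (l i))) =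
      q ^ n * gauss \<psi> (\<alpha> \<otimes>\<^bsub>mchars\<^esub> \<tau>) / gauss \<psi> \<alpha> *
        ((\<Prod>i=1..n. \<nu> i (l i)) / (\<Prod>i=1..n. gauss_circ \<psi> (\<nu> i))) *
        jacobi (n + 1) (\<lambda>i. if i \<le> n then \<delta> i else \<eta>)"
      unfolding jacobi_\<beta> jacobi_\<delta> p_one p_\<beta>
        poch_def[of \<psi> \<alpha>] poch_circ_def[of \<psi> \<gamma>]
      by (rule field) (use nz in auto)
    also have "jacobi (n + 1) (\<lambda>i. if i \<le> n then \<delta> i else \<eta>) =
        (-1) ^ n * (\<Sum>x\<in>?P. (\<Prod>i=1..n. \<delta> i (x i)) * ?C x)"
      by (rule jacobi_affine) (rule mchars_simps(1)[OF \<eta>(1)])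
    also have "q ^ n * gauss \<psi> (\<alpha> \<otimes>\<^bsub>mchars\<^esub> \<tau>) / gauss \<psi> \<alpha> *
        ((\<Prod>i=1..n. \<nu> i (l i)) / (\<Prod>i=1..n. gauss_circ \<psi> (\<nu> i))) * \<dots> =
      (\<Sum>x\<in>?P. (-1) ^ n * q ^ n / gauss \<psi> \<alpha> * (?B x * ?C x) *
       (gauss \<psi> (\<alpha> \<otimes>\<^bsub>mchars\<^esub> \<tau>) * (\<Prod>i=1..n. \<nu> i (l i * x i) / gauss_circ \<psi> (\<nu> i))))"
      unfolding sum_distrib_left
    proof (intro sum.cong refl)
      fix x
      have "(\<Prod>i=1..n. \<nu> i (l i * x i) / gauss_circ \<psi> (\<nu> i)) =
          (\<Prod>i=1..n. \<nu> i (l i)) * (\<Prod>i=1..n. \<nu> i (x i)) / (\<Prod>i=1..n. gauss_circ \<psi> (\<nu> i))"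
        by (simp add: prod_dividef mchars_simps(4)[OF \<nu>] prod.distrib)
      moreover have "(\<Prod>i=1..n. \<delta> i (x i)) = ?B x * (\<Prod>i=1..n. \<nu> i (x i))"
        by (simp add: \<delta>_def prod.distrib)
      ultimately show "q ^ n * gauss \<psi> (\<alpha> \<otimes>\<^bsub>mchars\<^esub> \<tau>) / gauss \<psi> \<alpha> *
          ((\<Prod>i=1..n. \<nu> i (l i)) / (\<Prod>i=1..n. gauss_circ \<psi> (\<nu> i))) *
          ((-1) ^ n * ((\<Prod>i=1..n. \<delta> i (x i)) * ?C x)) =
        (-1) ^ n * q ^ n / gauss \<psi> \<alpha> * (?B x * ?C x) *
          (gauss \<psi> (\<alpha> \<otimes>\<^bsub>mchars\<^esub> \<tau>) * (\<Prod>i=1..n. \<nu> i (l i * x i) / gauss_circ \<psi> (\<nu> i)))"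
        by (simp only: divide_inverse mult_ac)
    qed
    finally show ?thesis unfolding \<tau>_def .
  qed
  have "?J * ?F = 1 / (1 - q) ^ n * (\<Sum>\<nu>\<in>{1..n} \<rightarrow>\<^sub>E carrier mchars. ?J *
      ((poch \<psi> \<alpha> (finprod mchars \<nu> {1..n}) * (\<Prod>i=1..n. poch \<psi> (\<beta> i) (\<nu> i))) /
       (poch_circ \<psi> \<gamma> (finprod mchars \<nu> {1..n}) * (\<Prod>i=1..n. poch_circ \<psi> \<one>\<^bsub>mchars\<^esub> (\<nu> i))) *
       (\<Prod>i=1..n. \<nu> i (l i))))"
    unfolding lauricella_FD_def q_def[symmetric] \<gamma>_def[symmetric]
    by (simp only: sum_distrib_left[symmetric] mult.left_commute)
  also have "\<dots> = 1 / (1 - q) ^ n * (\<Sum>\<nu>\<in>{1..n} \<rightarrow>\<^sub>E carrier mchars.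
      \<Sum>x\<in>?P. (-1) ^ n * q ^ n / gauss \<psi> \<alpha> * (?B x * ?C x) *
       (gauss \<psi> (\<alpha> \<otimes>\<^bsub>mchars\<^esub> finprod mchars \<nu> {1..n}) * (\<Prod>i=1..n. \<nu> i (l i * x i) / gauss_circ \<psi> (\<nu> i))))"
    by (intro arg_cong2[of _ _ _ _ "(*)"] sum.cong refl summand)
  also have "\<dots> = (\<Sum>x\<in>?P. (-1) ^ n / ((1 - q) ^ n * gauss \<psi> \<alpha>) * (?B x * ?C x) * (q ^ n *
      (\<Sum>\<nu>\<in>{1..n} \<rightarrow>\<^sub>E carrier mchars.
       gauss \<psi> (\<alpha> \<otimes>\<^bsub>mchars\<^esub> finprod mchars \<nu> {1..n}) * (\<Prod>i=1..n. \<nu> i (l i * x i) / gauss_circ \<psi> (\<nu> i)))))"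
    by (subst sum.swap) (simp add: sum_distrib_left mult_ac)
  also have "\<dots> = (\<Sum>x\<in>?P. (-1) ^ n / ((1 - q) ^ n * gauss \<psi> \<alpha>) * (?B x * ?C x) *
      ((1 - q) ^ n * (gauss \<psi> \<alpha> * inverse (\<alpha> (?A x)))))"
  proof (rule sum.cong[OF refl])
    fix x assume x: "x \<in> ?P"
    have "l i * x i \<noteq> 0" if "i \<in> {1..n}" for i
      using l[OF that] PiE_mem[OF x that] by simp
    hence expansion: "q ^ n * (\<Sum>\<nu>\<in>{1..n} \<rightarrow>\<^sub>E carrier mchars.
       gauss \<psi> (\<alpha> \<otimes>\<^bsub>mchars\<^esub> finprod mchars \<nu> {1..n}) * (\<Prod>i=1..n. \<nu> i (l i * x i) / gauss_circ \<psi> (\<nu> i))) =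
      (1 - q) ^ n * (gauss \<psi> \<alpha> * inverse (\<alpha> (?A x)))"
      using inverse_mchar_expansion[OF \<psi> _ \<alpha>, of "{1..n}" "\<lambda>i. l i * x i"] by (simp add: q_def)
    show "(-1) ^ n / ((1 - q) ^ n * gauss \<psi> \<alpha>) * (?B x * ?C x) * (q ^ n *
        (\<Sum>\<nu>\<in>{1..n} \<rightarrow>\<^sub>E carrier mchars.
         gauss \<psi> (\<alpha> \<otimes>\<^bsub>mchars\<^esub> finprod mchars \<nu> {1..n}) * (\<Prod>i=1..n. \<nu> i (l i * x i) / gauss_circ \<psi> (\<nu> i)))) =
      (-1) ^ n / ((1 - q) ^ n * gauss \<psi> \<alpha>) * (?B x * ?C x) *
        ((1 - q) ^ n * (gauss \<psi> \<alpha> * inverse (\<alpha> (?A x))))"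
      unfolding expansion ..
  qed
  also have "\<dots> = (-1) ^ n * (\<Sum>x\<in>?P. inverse (\<alpha> (?A x)) * (?B x * ?C x))"
    using q gauss_neq_0[OF \<psi> \<alpha>(1)] unfolding sum_distrib_left
    by (intro sum.cong refl) (simp add: field_simps)
  finally show ?thesis .
qed

section \<open>Points of the hypersurface\<close>

text \<open>
  A root \<open>y\<close> of \<open>y\<^sup>d = t\<close> with \<open>t \<noteq> 0\<close> satisfies \<open>y\<^sup>q = t\<^sup>(\<^sup>q\<^sup>-\<^sup>1\<^sup>)\<^sup>/\<^sup>d y\<close>, so Frobenius acts on the whole
  fibre above \<open>t\<close> through one element of \<open>\<mu>\<^sub>d\<close>. Above \<open>t = 0\<close> there is only \<open>y = 0\<close>, which satisfies
  the equation for every \<open>\<xi>\<close>.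
\<close>
lemma frobenius_fibre:
  fixes t :: "'k :: {field, finite}"
  assumes d: "d > 0" "d dvd CARD('k) - 1"
  shows "finite {y. y ^ d = to_ac t \<and> y ^ CARD('k) = to_ac \<xi> * y}"
    and "(\<Sum>\<xi> | \<xi> ^ d = 1. \<theta> \<xi> * of_nat (card {y. y ^ d = to_ac t \<and> y ^ CARD('k) = to_ac \<xi> * y})) =
      (if t = 0 then (\<Sum>\<xi> | \<xi> ^ d = 1. \<theta> \<xi>) else of_nat d * (\<theta> (t ^ ((CARD('k) - 1) div d)) :: qbar))"
proof -
  let ?e = "(CARD('k) - 1) div d"
  let ?Y = "\<lambda>\<xi>. {y. y ^ d = to_ac t \<and> y ^ CARD('k) = to_ac \<xi> * y}"
  have "finite (?Y \<xi>) \<and> (\<Sum>\<xi> | \<xi> ^ d = 1. \<theta> \<xi> * of_nat (card (?Y \<xi>))) =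
      (if t = 0 then (\<Sum>\<xi> | \<xi> ^ d = 1. \<theta> \<xi>) else of_nat d * \<theta> (t ^ ?e))"
  proof (cases "t = 0")
    case True
    have "?Y \<xi> = {0}" for \<xi>
      using d(1) True by (auto simp: power_0_left)
    thus ?thesis using True by simp
  next
    case False
    have card: "card {y. y ^ d = to_ac t} = d"
      using card_nth_roots_of_unity(2)[OF d(2) False] .
    hence fin: "finite {y. y ^ d = to_ac t}" using d(1) by (intro card_ge_0_finite) simp
    have frob_y: "y ^ CARD('k) = to_ac (t ^ ?e) * y" if "y ^ d = to_ac t" for y
    proof -
      have "CARD('k) = Suc (d * ?e)" using d(2) CARD_ge_2[where 'k = 'k] by simp
      hence "y ^ CARD('k) = y * (y ^ d) ^ ?e" by (metis power_Suc power_mult)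
      thus ?thesis using that by simp
    qed
    have Y: "?Y \<xi> = (if \<xi> = t ^ ?e then {y. y ^ d = to_ac t} else {})" for \<xi>
    proof -
      have "y \<noteq> 0" if "y ^ d = to_ac t" for y
        using that False d(1) by (auto simp: power_0_left)
      thus ?thesis using frob_y by (auto simp flip: to_ac_power)
    qed
    have "(t ^ ?e) ^ d = t ^ (CARD('k) - 1)"
      using d(2) by (simp flip: power_mult)
    hence mem: "(t ^ ?e) ^ d = 1" using power_CARD_minus_1[OF False] by simp
    have "(\<Sum>\<xi> | \<xi> ^ d = 1. \<theta> \<xi> * of_nat (card (?Y \<xi>))) =
        (\<Sum>\<xi> | \<xi> ^ d = 1. if \<xi> = t ^ ?e then of_nat d * \<theta> \<xi> else 0)"
      by (intro sum.cong refl) (simp add: Y card)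
    also have "\<dots> = of_nat d * \<theta> (t ^ ?e)" using mem by (subst sum.delta) auto
    finally show ?thesis using False fin by (simp add: Y)
  qed
  thus "finite (?Y \<xi>)" and "(\<Sum>\<xi> | \<xi> ^ d = 1. \<theta> \<xi> * of_nat (card (?Y \<xi>))) =
      (if t = 0 then (\<Sum>\<xi> | \<xi> ^ d = 1. \<theta> \<xi>) else of_nat d * \<theta> (t ^ ?e))"
    by simp_all
qed

definition S_D_rhs :: "nat \<Rightarrow> nat \<Rightarrow> (nat \<Rightarrow> nat) \<Rightarrow> nat \<Rightarrow> (nat \<Rightarrow> 'k) \<Rightarrow> (nat \<Rightarrow> 'k) \<Rightarrow> 'k :: field"
  where "S_D_rhs n a b c l x =
    (1 - (\<Sum>i=1..n. l i * x i)) ^ a * (\<Prod>i=1..n. x i ^ b i) * (1 - (\<Sum>i=1..n. x i)) ^ c"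

text \<open>
  The group acts on \<open>y\<close> alone, so the base coordinates of a twisted fixed point are fixed by
  Frobenius, hence rational.
\<close>
lemma card_S_D_twisted_fixed_points:
  fixes l :: "nat \<Rightarrow> 'k :: {field, finite}"
  assumes d: "d > 0" "d dvd CARD('k) - 1"
  shows "card {p \<in> S_D n d a b c l. (frob n ^^ 1) p = mu_act \<xi> p} =
    (\<Sum>u\<in>{1..n} \<rightarrow>\<^sub>E UNIV. card {y. y ^ d = to_ac (S_D_rhs n a b c l u) \<and> y ^ CARD('k) = to_ac \<xi> * y})"
proof -
  let ?Y = "\<lambda>u. {y. y ^ d = to_ac (S_D_rhs n a b c l u) \<and> y ^ CARD('k) = to_ac \<xi> * y}"
  let ?h = "\<lambda>(u, y). (\<lambda>i\<in>{1..n}. to_ac (u i), y)"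
  have rhs: "to_ac (S_D_rhs n a b c l u) =
      (1 - (\<Sum>i=1..n. to_ac (l i) * to_ac (u i))) ^ a * (\<Prod>i=1..n. to_ac (u i) ^ b i) *
      (1 - (\<Sum>i=1..n. to_ac (u i))) ^ c" for u
    by (simp add: S_D_rhs_def to_ac_sum to_ac_prod)
  have "{p \<in> S_D n d a b c l. (frob n ^^ 1) p = mu_act \<xi> p} = ?h ` Sigma ({1..n} \<rightarrow>\<^sub>E UNIV) ?Y"
  proof (intro equalityI subsetI)
    fix p assume p: "p \<in> {p \<in> S_D n d a b c l. (frob n ^^ 1) p = mu_act \<xi> p}"
    obtain x y where xy: "p = (x, y)" by (cases p)
    from p have x: "x \<in> {1..n} \<rightarrow>\<^sub>E UNIV"
      and eq: "y ^ d = (1 - (\<Sum>i=1..n. to_ac (l i) * x i)) ^ a * (\<Prod>i=1..n. x i ^ b i) * (1 - (\<Sum>i=1..n. x i)) ^ c"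
      and fx: "(\<lambda>i\<in>{1..n}. x i ^ CARD('k)) = x" and fy: "y ^ CARD('k) = to_ac \<xi> * y"
      by (auto simp: xy S_D_def frob_def mu_act_def)
    define u where "u = (\<lambda>i\<in>{1..n}. of_ac (x i))"
    have ux: "to_ac (u i) = x i" if "i \<in> {1..n}" for i
    proof -
      have "x i ^ CARD('k) = x i" using fun_cong[OF fx, of i] that by simp
      hence "x i \<in> range to_ac" unfolding range_to_ac_eq_frobenius_fixed by simp
      thus ?thesis using that by (simp add: u_def to_ac_of_ac)
    qed
    have "y ^ d = to_ac (S_D_rhs n a b c l u)"
      unfolding rhs eq using ux by simp
    moreover have "(\<lambda>i\<in>{1..n}. to_ac (u i)) = x"
      using x ux by (auto simp: fun_eq_iff PiE_def extensional_def)
    moreover have "u \<in> {1..n} \<rightarrow>\<^sub>E UNIV" by (simp add: u_def)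
    ultimately show "p \<in> ?h ` Sigma ({1..n} \<rightarrow>\<^sub>E UNIV) ?Y"
      using fy by (intro image_eqI[of _ _ "(u, y)"]) (auto simp: xy)
  next
    fix p assume "p \<in> ?h ` Sigma ({1..n} \<rightarrow>\<^sub>E UNIV) ?Y"
    then obtain u y where p: "p = (\<lambda>i\<in>{1..n}. to_ac (u i), y)" and y: "y \<in> ?Y u" by auto
    have "to_ac (u i) ^ CARD('k) = to_ac (u i)" for i
      by (simp add: power_CARD flip: to_ac_power)
    thus "p \<in> {p \<in> S_D n d a b c l. (frob n ^^ 1) p = mu_act \<xi> p}"
      using y by (auto simp: p rhs S_D_def frob_def mu_act_def fun_eq_iff)
  qed
  moreover have "inj_on ?h (Sigma ({1..n} \<rightarrow>\<^sub>E UNIV) ?Y)"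
  proof (intro inj_onI, clarify, intro conjI)
    fix u u' :: "nat \<Rightarrow> 'k" and y y' :: "'k alg_closure"
    assume u: "u \<in> {1..n} \<rightarrow>\<^sub>E UNIV" "u' \<in> {1..n} \<rightarrow>\<^sub>E UNIV"
      and eq: "(\<lambda>i\<in>{1..n}. to_ac (u i)) = (\<lambda>i\<in>{1..n}. to_ac (u' i))"
    show "u = u'"
    proof (rule PiE_ext[OF u])
      fix i assume "i \<in> {1..n}"
      thus "u i = u' i" using fun_cong[OF eq, of i] by simp
    qed
  qed simp
  ultimately have "card {p \<in> S_D n d a b c l. (frob n ^^ 1) p = mu_act \<xi> p} = card (Sigma ({1..n} \<rightarrow>\<^sub>E UNIV) ?Y)"
    by (simp only: card_image)
  also have "\<dots> = (\<Sum>u\<in>{1..n} \<rightarrow>\<^sub>E UNIV. card (?Y u))"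
    using frobenius_fibre(1)[OF d] by (intro card_SigmaI) (auto simp: finite_PiE)
  finally show ?thesis .
qed

lemma twisted_count_S_D:
  fixes l :: "nat \<Rightarrow> 'k :: {field, finite}"
  assumes d: "d > 0" "d dvd CARD('k) - 1"
  shows "twisted_count (mu d) (S_D n d a b c l) (frob n) mu_act 1 \<theta> =
    (\<Sum>u\<in>{1..n} \<rightarrow>\<^sub>E UNIV. if S_D_rhs n a b c l u = 0 then (\<Sum>\<xi> | \<xi> ^ d = 1. \<theta> \<xi>) / of_nat d
      else \<theta> (S_D_rhs n a b c l u ^ ((CARD('k) - 1) div d)))"
proof -
  let ?f = "S_D_rhs n a b c l"
  have "twisted_count (mu d) (S_D n d a b c l) (frob n) mu_act 1 \<theta> =
      1 / of_nat d * (\<Sum>\<xi> | \<xi> ^ d = 1. \<Sum>u\<in>{1..n} \<rightarrow>\<^sub>E UNIV.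
        \<theta> \<xi> * of_nat (card {y. y ^ d = to_ac (?f u) \<and> y ^ CARD('k) = to_ac \<xi> * y}))"
    unfolding twisted_count_def mu_simps card_S_D_twisted_fixed_points[OF d]
      card_nth_roots_of_unity(1)[OF d(2)]
    by (simp add: sum_distrib_left)
  also have "\<dots> = 1 / of_nat d * (\<Sum>u\<in>{1..n} \<rightarrow>\<^sub>E UNIV.
      if ?f u = 0 then (\<Sum>\<xi> | \<xi> ^ d = 1. \<theta> \<xi>) else of_nat d * \<theta> (?f u ^ ((CARD('k) - 1) div d)))"
    by (subst sum.swap) (simp only: frobenius_fibre(2)[OF d])
  also have "\<dots> = (\<Sum>u\<in>{1..n} \<rightarrow>\<^sub>E UNIV. if ?f u = 0 then (\<Sum>\<xi> | \<xi> ^ d = 1. \<theta> \<xi>) / of_nat d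
      else \<theta> (?f u ^ ((CARD('k) - 1) div d)))"
    unfolding sum_distrib_left using d(1) by (intro sum.cong refl) auto
  finally show ?thesis .
qed

text \<open>
  If the \<open>k\<close>-th power of \<open>\<phi>\<close> were trivial then so would be the \<open>k\<close>-th power of every character,
  and every \<open>(q - 1)\<close>-th root of unity, being a character value, would have trivial \<open>k\<close>-th power.
\<close>
lemma generating_mchar_powi_neq_1:
  fixes \<phi> :: "'k :: {field, finite} \<Rightarrow> qbar" and k :: int
  assumes \<phi>: "\<phi> \<in> carrier mchars" and gen: "generate mchars {\<phi>} = carrier mchars"
    and k: "\<not> int (CARD('k) - 1) dvd k"
  obtains h where "h \<noteq> 0" "\<phi> h powi k \<noteq> 1"
proof -
  interpret M: comm_group "mchars :: ('k \<Rightarrow> qbar) monoid"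
    by (rule comm_group_char_group[OF group_mult_grp])
  obtain g :: 'k where g: "g \<noteq> 0" "bij_betw (\<lambda>k. g ^ k) {..<CARD('k) - 1} (UNIV - {0})"
    by (rule finite_field_generator_bij)
  have "CARD('k) - 1 > 0" using CARD_ge_2[where 'k = 'k] by simp
  then obtain z :: qbar where z: "z ^ (CARD('k) - 1) = 1" "z powi k \<noteq> 1"
    using ex_root_of_unity_power_neq_1[OF _ k] by blast
  have "z \<in> (\<lambda>\<nu>. \<nu> g) ` carrier mchars"
    using z(1) by (subst bij_betw_imp_surj_on[OF mchars_eval_generator_bij[OF g]]) simp
  then obtain \<nu> where \<nu>: "\<nu> \<in> carrier mchars" "\<nu> g = z" by auto
  then obtain j :: int where "\<nu> = \<phi> [^]\<^bsub>mchars\<^esub> j"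
    using M.generate_pow[OF \<phi>] gen by auto
  hence "z = \<phi> g powi j"
    using char_group_pow_apply[OF group_mult_grp \<phi>, of g j] g(1) \<nu>(2) by simp
  hence "z powi k = (\<phi> g powi k) powi j"
    by (simp add: mult.commute flip: power_int_mult)
  hence "\<phi> g powi k \<noteq> 1" using z(2) by auto
  thus ?thesis using that g(1) by blast
qed

theorem theorem4p4:
  fixes \<psi> \<phi> \<phi>\<^sub>d \<chi> :: "'k :: {field, finite} \<Rightarrow> qbar"
    and n d a c :: nat and b :: "nat \<Rightarrow> nat"
    and l :: "nat \<Rightarrow> 'k" and m :: int
  assumes "\<psi> \<in> carrier (char_group add_grp)" and "\<psi> \<noteq> \<one>\<^bsub>char_group add_grp\<^esub>"
    and "\<phi> \<in> carrier mchars" and "generate mchars {\<phi>} = carrier mchars"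
    and "\<phi>\<^sub>d = \<phi> [^]\<^bsub>mchars\<^esub> ((CARD('k) - 1) div d)"
    and "\<chi> = char_restrict (mu d) \<phi>"
    and "n > 0" and "d > 0" and "a > 0" and "c > 0"
    and "\<And>i. i \<in> {1..n} \<Longrightarrow> b i > 0"
    and "d dvd CARD('k) - 1"
    and "\<And>i. i \<in> {1..n} \<Longrightarrow> l i \<noteq> 0"
    and "gcd d a = 1" and "gcd d c = 1"
  shows "twisted_count (mu d) (S_D n d a b c l) (frob n) mu_act 1 (\<chi> [^]\<^bsub>char_group (mu d)\<^esub> m) =
    (if int d dvd m then of_nat CARD('k) ^ n
     else (-1) ^ n *
       jacobi (n + 1) (\<lambda>i. \<phi>\<^sub>d [^]\<^bsub>mchars\<^esub> (m * int (if i \<le> n then b i else c))) *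
       lauricella_FD \<psi> n
         ((inv\<^bsub>mchars\<^esub> \<phi>\<^sub>d) [^]\<^bsub>mchars\<^esub> (m * int a))
         (\<lambda>i. \<phi>\<^sub>d [^]\<^bsub>mchars\<^esub> (m * int (b i)))
         (\<phi>\<^sub>d [^]\<^bsub>mchars\<^esub> (m * int ((\<Sum>i=1..n. b i) + c)))
         l)"
proof -
  note \<psi> = assms(1,2) and \<phi> = assms(3) and d = assms(8,12)
  define e where "e = (CARD('k) - 1) div d"
  have de: "CARD('k) - 1 = d * e" using d(2) by (simp add: e_def)
  let ?f = "S_D_rhs n a b c l"
  define \<theta> where "\<theta> = \<chi> [^]\<^bsub>char_group (mu d)\<^esub> m"
  define \<omega> where "\<omega> = \<phi>\<^sub>d [^]\<^bsub>mchars\<^esub> m"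
  have \<phi>d_eq: "\<phi>\<^sub>d = \<phi> [^]\<^bsub>mchars\<^esub> int e" by (simp add: assms(5) e_def int_pow_int)
  have \<phi>d_in: "\<phi>\<^sub>d \<in> carrier mchars"
    unfolding \<phi>d_eq by (rule mchars_pow_closed[OF \<phi>])
  have \<phi>d: "\<phi>\<^sub>d x = \<phi> x ^ e" if "x \<noteq> 0" for x
    using char_group_pow_apply[OF group_mult_grp \<phi>, of x "int e"] that by (simp add: \<phi>d_eq)
  have \<phi>d_pow: "(\<phi>\<^sub>d [^]\<^bsub>mchars\<^esub> k) x = \<phi>\<^sub>d x powi k" if "x \<noteq> 0" for x and k :: int
    using that by (intro char_group_pow_apply[OF group_mult_grp \<phi>d_in]) auto
  have \<omega>_in: "\<omega> \<in> carrier mchars" unfolding \<omega>_def by (rule mchars_pow_closed[OF \<phi>d_in])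
  have nonzero: "x \<noteq> 0" if "x ^ d = 1" for x :: 'k using that d(1) by (auto simp: power_0_left)
  have "\<chi> \<in> carrier (char_group (mu d))"
    using mchars_simps(2,4)[OF \<phi>] nonzero
    by (auto simp: assms(6) char_restrict_def char_group_def hom_def power_mult_distrib)
  hence \<theta>: "\<theta> \<xi> = \<phi> \<xi> powi m" if "\<xi> ^ d = 1" for \<xi>
    using char_group_pow_apply[OF group_mu[OF d(1)], of \<chi> \<xi> m] that
    by (simp add: \<theta>_def assms(6) char_restrict_def)
  have root: "(t ^ e) ^ d = 1" if "t \<noteq> 0" for t :: 'k
    using power_CARD_minus_1[OF that] unfolding de by (metis mult.commute power_mult)
  \<comment> \<open>passage from the character of \<open>\<mu>\<^sub>d\<close>, taken at the power residue of \<open>t\<close>, to a character of the field\<close>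
  have \<theta>\<omega>: "\<theta> (t ^ e) = \<omega> t" if "t \<noteq> 0" for t
    using \<theta>[OF root[OF that]] that by (simp add: \<omega>_def \<phi>d_pow \<phi>d mchars_simps(5)[OF \<phi>])
  have count: "twisted_count (mu d) (S_D n d a b c l) (frob n) mu_act 1 \<theta> =
      (\<Sum>u\<in>{1..n} \<rightarrow>\<^sub>E UNIV. if ?f u = 0 then (\<Sum>\<xi> | \<xi> ^ d = 1. \<theta> \<xi>) / of_nat d else \<omega> (?f u))"
    unfolding twisted_count_S_D[OF d] e_def[symmetric]
    by (intro sum.cong refl) (simp add: \<theta>\<omega>)
  show ?thesis
  proof (cases "int d dvd m")
    case True
    then obtain j where j: "m = int d * j" by blast
    have "\<theta> \<xi> = 1" if "\<xi> ^ d = 1" for \<xi>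
      using that \<theta>[OF that] by (simp add: j power_int_mult mchars_simps(3)[OF \<phi>] flip: mchars_simps(5)[OF \<phi>])
    moreover from this have "\<omega> t = 1" if "t \<noteq> 0" for t
      using \<theta>\<omega>[OF that] root[OF that] by simp
    ultimately have "(\<Sum>u\<in>{1..n} \<rightarrow>\<^sub>E UNIV. if ?f u = 0 then (\<Sum>\<xi> | \<xi> ^ d = 1. \<theta> \<xi>) / of_nat d else \<omega> (?f u)) =
        (\<Sum>u\<in>{1..n} \<rightarrow>\<^sub>E (UNIV :: 'k set). 1)"
      using d(1) by (intro sum.cong refl) (simp add: card_nth_roots_of_unity(1)[OF d(2)])
    also have "\<dots> = of_nat CARD('k) ^ n" by (simp add: card_PiE)
    finally show ?thesis using True count by (simp add: \<theta>_def)
  next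
    case False
    have nontriv: "\<exists>h. h \<noteq> 0 \<and> \<phi>\<^sub>d h powi k \<noteq> 1" if k: "\<not> int d dvd k" for k
    proof -
      have "e \<noteq> 0" using de CARD_ge_2[where 'k = 'k] by (cases e) auto
      hence "\<not> int (CARD('k) - 1) dvd int e * k" using k unfolding de by (simp add: mult.commute)
      then obtain h where "h \<noteq> 0" "\<phi> h powi (int e * k) \<noteq> 1"
        using generating_mchar_powi_neq_1[OF \<phi> assms(4)] by blast
      thus ?thesis by (intro exI[of _ h]) (simp add: \<phi>d power_int_mult)
    qed
    have not_dvd: "\<not> int d dvd m * int k" if "gcd d k = 1" for k
      using False that by (simp add: coprime_dvd_mult_left_iff coprime_iff_gcd_eq_1)
    \<comment> \<open>hence the zeros of the defining polynomial do not contribute\<close>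
    have \<theta>_sum: "(\<Sum>\<xi> | \<xi> ^ d = 1. \<theta> \<xi>) = 0"
    proof -
      obtain h where h: "h \<noteq> 0" "\<phi>\<^sub>d h powi m \<noteq> 1" using nontriv[OF False] by blast
      define \<zeta> where "\<zeta> = h ^ e"
      have \<zeta>: "\<zeta> ^ d = 1" "\<theta> \<zeta> \<noteq> 1"
        using root[OF h(1)] \<theta>\<omega>[OF h(1)] h by (auto simp: \<zeta>_def \<omega>_def \<phi>d_pow)
      have \<theta>_mult: "\<theta> (\<zeta> * \<xi>) = \<theta> \<zeta> * \<theta> \<xi>" if "\<xi> ^ d = 1" for \<xi>
        using that \<zeta>(1) by (simp add: \<theta> power_mult_distrib mchars_simps(4)[OF \<phi>] power_int_mult_distrib)
      have "(\<Sum>\<xi> | \<xi> ^ d = 1. \<theta> \<xi>) = (\<Sum>\<xi> | \<xi> ^ d = 1. \<theta> (\<zeta> * \<xi>))"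
        by (rule sum.reindex_bij_witness[of _ "\<lambda>\<xi>. \<zeta> * \<xi>" "\<lambda>\<xi>. \<xi> / \<zeta>"])
           (use \<zeta>(1) nonzero[OF \<zeta>(1)] in \<open>auto simp: power_mult_distrib power_divide\<close>)
      also have "\<dots> = \<theta> \<zeta> * (\<Sum>\<xi> | \<xi> ^ d = 1. \<theta> \<xi>)"
        unfolding sum_distrib_left by (intro sum.cong refl) (simp add: \<theta>_mult)
      finally show ?thesis using \<zeta>(2) by simp
    qed
    define \<alpha> where "\<alpha> = (inv\<^bsub>mchars\<^esub> \<phi>\<^sub>d) [^]\<^bsub>mchars\<^esub> (m * int a)"
    define \<beta> where "\<beta> i = \<phi>\<^sub>d [^]\<^bsub>mchars\<^esub> (m * int (b i))" for i
    define \<eta> where "\<eta> = \<phi>\<^sub>d [^]\<^bsub>mchars\<^esub> (m * int c)"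
    have \<alpha>_in: "\<alpha> \<in> carrier mchars" and \<beta>_in: "\<beta> i \<in> carrier mchars" and \<eta>_in: "\<eta> \<in> carrier mchars" for i
      unfolding \<alpha>_def \<beta>_def \<eta>_def by (intro mchars_pow_closed mchars_inv_closed \<phi>d_in)+
    have \<phi>d_\<omega>: "(\<phi>\<^sub>d [^]\<^bsub>mchars\<^esub> (m * int k)) x = \<omega> x ^ k" if "k > 0" for k x
      using that mchars_simps(1)[OF mchars_pow_closed[OF \<phi>d_in, of "m * int k"]] mchars_simps(1)[OF \<omega>_in]
      by (cases "x = 0") (simp_all add: \<phi>d_pow \<omega>_def power_int_mult)
    have \<alpha>: "inverse (\<alpha> x) = \<omega> x ^ a" for x
    proof (cases "x = 0")
      case False
      have "\<alpha> x = inverse (\<phi>\<^sub>d x) powi (m * int a)"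
        unfolding \<alpha>_def using False
        by (simp add: char_group_pow_apply[OF group_mult_grp mchars_inv_closed[OF \<phi>d_in]]
          char_group_inv_apply[OF group_mult_grp \<phi>d_in])
      also have "\<dots> = inverse (\<omega> x ^ a)"
        using False by (simp add: \<omega>_def \<phi>d_pow power_int_mult power_int_inverse power_inverse)
      finally show ?thesis by simp
    qed (use assms(9) mchars_simps(1)[OF \<alpha>_in] mchars_simps(1)[OF \<omega>_in] in simp)
    have "\<alpha> \<noteq> \<one>\<^bsub>mchars\<^esub>"
    proof
      assume triv: "\<alpha> = \<one>\<^bsub>mchars\<^esub>"
      obtain h where h: "h \<noteq> 0" "\<phi>\<^sub>d h powi (m * int a) \<noteq> 1"
        using nontriv[OF not_dvd[OF assms(14)]] by blast
      have "inverse (\<alpha> h) = 1" using h(1) by (simp add: triv)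
      thus False using \<alpha>[of h] h by (simp add: \<omega>_def \<phi>d_pow power_int_mult)
    qed
    moreover have "\<eta> \<noteq> \<one>\<^bsub>mchars\<^esub>"
    proof
      assume triv: "\<eta> = \<one>\<^bsub>mchars\<^esub>"
      obtain h where h: "h \<noteq> 0" "\<phi>\<^sub>d h powi (m * int c) \<noteq> 1"
        using nontriv[OF not_dvd[OF assms(15)]] by blast
      have "\<eta> h = 1" using h(1) by (simp add: triv)
      thus False using h by (simp add: \<eta>_def \<phi>d_pow)
    qed
    moreover have "\<phi>\<^sub>d [^]\<^bsub>mchars\<^esub> (m * int ((\<Sum>i=1..n. b i) + c)) = finprod mchars \<beta> {1..n} \<otimes>\<^bsub>mchars\<^esub> \<eta>"
    proof (rule mchars_eqI)
      fix x :: 'k assume x: "x \<noteq> 0"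
      have "finprod mchars \<beta> {1..n} x = (\<Prod>i=1..n. \<beta> i x)"
        using x \<beta>_in by (intro char_group_finprod_apply[OF group_mult_grp]) auto
      also have "\<dots> = (\<Prod>i=1..n. \<omega> x ^ b i)"
        using assms(11) by (intro prod.cong refl) (simp add: \<beta>_def \<phi>d_\<omega>)
      also have "\<dots> = \<omega> x ^ (\<Sum>i=1..n. b i)" by (simp add: power_sum)
      finally show "(\<phi>\<^sub>d [^]\<^bsub>mchars\<^esub> (m * int ((\<Sum>i=1..n. b i) + c))) x =
          (finprod mchars \<beta> {1..n} \<otimes>\<^bsub>mchars\<^esub> \<eta>) x"
        using assms(10) \<phi>d_\<omega>[of "(\<Sum>i=1..n. b i) + c" x] by (simp add: \<eta>_def \<phi>d_\<omega> power_add)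
    qed (use \<phi>d_in \<beta>_in \<eta>_in in \<open>auto intro!: mchars_pow_closed mchars_mult_closed mchars_finprod_closed\<close>)
    moreover have "(\<lambda>i. \<phi>\<^sub>d [^]\<^bsub>mchars\<^esub> (m * int (if i \<le> n then b i else c))) = (\<lambda>i. if i \<le> n then \<beta> i else \<eta>)"
      by (auto simp: \<beta>_def \<eta>_def)
    ultimately have JF: "jacobi (n + 1) (\<lambda>i. \<phi>\<^sub>d [^]\<^bsub>mchars\<^esub> (m * int (if i \<le> n then b i else c))) *
        lauricella_FD \<psi> n \<alpha> \<beta> (\<phi>\<^sub>d [^]\<^bsub>mchars\<^esub> (m * int ((\<Sum>i=1..n. b i) + c))) l =
      (-1) ^ n * (\<Sum>x\<in>{1..n} \<rightarrow>\<^sub>E UNIV - {0}. inverse (\<alpha> (1 - (\<Sum>i=1..n. l i * x i))) *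
        ((\<Prod>i=1..n. \<beta> i (x i)) * \<eta> (1 - (\<Sum>i=1..n. x i))))"
      using jacobi_times_lauricella_FD[OF \<psi> \<alpha>_in _ \<beta>_in \<eta>_in _ assms(13)] by simp
    have "twisted_count (mu d) (S_D n d a b c l) (frob n) mu_act 1 \<theta> =
        (\<Sum>u\<in>{1..n} \<rightarrow>\<^sub>E UNIV. \<omega> (?f u))"
      unfolding count by (intro sum.cong refl) (simp add: \<theta>_sum mchars_simps(1)[OF \<omega>_in])
    also have "\<dots> = (\<Sum>u\<in>{1..n} \<rightarrow>\<^sub>E UNIV - {0}. \<omega> (?f u))"
    proof (rule sum.mono_neutral_right)
      show "\<forall>u\<in>({1..n} \<rightarrow>\<^sub>E UNIV) - ({1..n} \<rightarrow>\<^sub>E UNIV - {0}). \<omega> (?f u) = 0"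
      proof
        fix u :: "nat \<Rightarrow> 'k" assume u: "u \<in> ({1..n} \<rightarrow>\<^sub>E UNIV) - ({1..n} \<rightarrow>\<^sub>E UNIV - {0})"
        then obtain i where i: "i \<in> {1..n}" "u i = 0" by (auto simp: PiE_def Pi_def)
        hence zero: "(\<Prod>i=1..n. u i ^ b i) = 0"
          using assms(11) by (intro prod_zero bexI[of _ i]) (auto simp: power_0_left)
        show "\<omega> (?f u) = 0" unfolding S_D_rhs_def zero by (simp add: mchars_simps(1)[OF \<omega>_in])
      qed
    qed (auto intro: finite_PiE dest: PiE_mem)
    also have "\<dots> = (\<Sum>x\<in>{1..n} \<rightarrow>\<^sub>E UNIV - {0}. inverse (\<alpha> (1 - (\<Sum>i=1..n. l i * x i))) *
        ((\<Prod>i=1..n. \<beta> i (x i)) * \<eta> (1 - (\<Sum>i=1..n. x i))))"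
    proof (intro sum.cong refl)
      fix x
      have "(\<Prod>i=1..n. \<beta> i (x i)) = (\<Prod>i=1..n. \<omega> (x i) ^ b i)"
        using assms(11) by (intro prod.cong refl) (simp add: \<beta>_def \<phi>d_\<omega>)
      thus "\<omega> (?f x) = inverse (\<alpha> (1 - (\<Sum>i=1..n. l i * x i))) *
          ((\<Prod>i=1..n. \<beta> i (x i)) * \<eta> (1 - (\<Sum>i=1..n. x i)))"
        using assms(10) by (simp add: S_D_rhs_def \<alpha> \<eta>_def \<phi>d_\<omega> mchars_simps(4,5,7)[OF \<omega>_in] mult.assoc)
    qed
    also have "\<dots> = (-1) ^ n * (jacobi (n + 1) (\<lambda>i. \<phi>\<^sub>d [^]\<^bsub>mchars\<^esub> (m * int (if i \<le> n then b i else c))) *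
        lauricella_FD \<psi> n \<alpha> \<beta> (\<phi>\<^sub>d [^]\<^bsub>mchars\<^esub> (m * int ((\<Sum>i=1..n. b i) + c))) l)"
      unfolding JF by (simp flip: mult.assoc power_mult_distrib)
    finally show ?thesis
      using False by (simp only: \<theta>_def \<alpha>_def \<beta>_def[abs_def] if_False mult.assoc)
  qed
qed

end
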